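(* Let $b\ge 3$ and $m\ge 2$ be integers. For any $p,q \in \mathbb{N}$, there exists $\lambda_{p,q} >1$ such that the set $K^\omega$ is $\frac{\log \lambda_{p,q}}{(p+q) \log b}$-Ahlfors regular for all $\omega \in L_{p,q}$. Moreover, the set $$\bigg\{ \frac{\log \lambda_{p,q}}{(p+q)\log b}: p,q \in \mathbb{N} \bigg\}$$ is dense in $[\frac{\log\eta}{\log b}, \frac{\log\lambda}{\log b}]$, where $\lambda\in(b-1,b)$ is the Pisot number satisfying $x^m-(b-1)(x^{m-1}+x^{m-2}+\cdots+x+1)=0$ and $\eta\in(b-1,b)$ is the Pisot number satisfying $x^m-bx^{m-1}+1=0$.
   Context: $\mathbb{N}=\{1,2,\ldots\}$, $\mathbb{N}_0=\mathbb{N}\cup\{0\}$, $D_b=\{0,1,\ldots,b-1\}$; $D_b^n$ is the set of words of length $n$ over $D_b$. $(D_b^m)^{\mathbb{N}_0}$ is the set of infinite sequences $\omega=\omega^0\omega^1\ldots$ with each $\omega^k=\omega^k_1\omega^k_2\ldots\omega^k_m\in D_b^m$ (superscripts are indices). For such $\omega$, $K^\omega=\{\sum_{i=1}^\infty d_ib^{-i}: d_i\in D_b\ \forall i\in\mathbb N,\ d_{k+1}d_{k+2}\ldots d_{k+m}\ne\omega^k\ \forall k\in\mathbb{N}_0\}$. For $k\in\mathbb{N}$, $\omega$ is progressively overlapping at position-$k$ if $\omega^k_1\ldots\omega^k_{m-j}=\omega^{k-j}_{j+1}\ldots\omega^{k-j}_m$ for all $1\le j\le\min\{k,m-1\}$,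 and totally distinct at position-$k$ if $\omega^k_1\ldots\omega^k_{m-j}\ne\omega^{k-j}_{j+1}\ldots\omega^{k-j}_m$ for all $1\le j\le\min\{k,m-1\}$. For $p,q\in\mathbb{N}$, $L_{p,q}$ is the (nonempty, in fact uncountable) set of sequences $\omega\in(D_b^m)^{\mathbb{N}_0}$ such that, for every $\ell\in\mathbb{N}_0$, $\omega$ is progressively overlapping at position-$k$ for all $\ell(p+q)<k\le\ell(p+q)+p$ and totally distinct at position-$k$ for all $\ell(p+q)+p<k\le(\ell+1)(p+q)$. A compact set $F\subset\mathbb{R}^n$ is $s$-Ahlfors regular if there is a constant $c\ge1$ such that $c^{-1}r^s\le\mathcal{H}^s(F\cap B(x,r))\le cr^s$ for all $0<r<1$ and all $x\in F$, where $\mathcal{H}^s$ is the $s$-dimensional Hausdorff measure and $B(x,r)$ the closed ball. A Pisot number is an algebraic integer greater than $1$ whose algebraic conjugates (other than itself) have modulus strictly less than $1$. *)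

theory Defs
  imports "HOL-Analysis.Analysis" "HOL-Computational_Algebra.Computational_Algebra"
begin

(* Convention 0^0 = 1 on nonempty sets, so that s = 0 gives counting measure
   (powr would give 0 for singletons). *)
definition diam_pow :: "real \<Rightarrow> 'a::metric_space set \<Rightarrow> real" where
  "diam_pow s U = (if U = {} then 0 else if s = 0 then 1 else diameter U powr s)"

(* The library's diameter is meaningful for bounded sets only, hence the boundedness condition. *)
definition hausdorff_premeasure :: "real \<Rightarrow> real \<Rightarrow> 'a::metric_space set \<Rightarrow> ennreal" where
  "hausdorff_premeasure s \<delta> A =
     (INF U \<in> {U :: nat \<Rightarrow> 'a set. A \<subseteq> (\<Union>i. U i) \<and> (\<forall>i. bounded (U i) \<and> diameter (U i) \<le> \<delta>)}.
        \<Sum>i. ennreal (diam_pow s (U i)))"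

definition hausdorff_measure :: "real \<Rightarrow> 'a::metric_space set \<Rightarrow> ennreal" where
  "hausdorff_measure s A = (SUP \<delta> \<in> {0<..}. hausdorff_premeasure s \<delta> A)"

definition ahlfors_regular :: "real \<Rightarrow> 'a::euclidean_space set \<Rightarrow> bool" where
  "ahlfors_regular s F \<longleftrightarrow> compact F \<and>
     (\<exists>c\<ge>1. \<forall>r x. 0 < r \<longrightarrow> r < 1 \<longrightarrow> x \<in> F \<longrightarrow>
        ennreal (inverse c * r powr s) \<le> hausdorff_measure s (F \<inter> cball x r) \<and>
        hausdorff_measure s (F \<inter> cball x r) \<le> ennreal (c * r powr s))"

(* x and z are roots of the same irreducible rational polynomial, which is, up to a unit, their
   common minimal polynomial. *)
definition algebraic_conjugates :: "complex \<Rightarrow> complex \<Rightarrow> bool" where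
  "algebraic_conjugates x z \<longleftrightarrow>
     (\<exists>f :: rat poly. irreducible f \<and> poly (map_poly of_rat f) x = 0 \<and> poly (map_poly of_rat f) z = 0)"

definition pisot :: "real \<Rightarrow> bool" where
  "pisot x \<longleftrightarrow> algebraic_int x \<and> x > 1 \<and>
     (\<forall>z. algebraic_conjugates (of_real x) z \<longrightarrow> z \<noteq> of_real x \<longrightarrow> norm z < 1)"

definition words :: "nat \<Rightarrow> nat \<Rightarrow> nat list set" where
  "words b m = {w. length w = m \<and> set w \<subseteq> {0..<b}}"

(* Digits are indexed from 1; the value of d at 0 is irrelevant. *)
definition K_set :: "nat \<Rightarrow> nat \<Rightarrow> (nat \<Rightarrow> nat list) \<Rightarrow> real set" where
  "K_set b m \<omega> = {(\<Sum>i. real (d (Suc i)) / real b ^ Suc i) | d.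
     (\<forall>i\<ge>1. d i < b) \<and> (\<forall>k. map d [k + 1..<k + m + 1] \<noteq> \<omega> k)}"

definition progressively_overlapping :: "nat \<Rightarrow> (nat \<Rightarrow> nat list) \<Rightarrow> nat \<Rightarrow> bool" where
  "progressively_overlapping m \<omega> k \<longleftrightarrow>
     (\<forall>j. 1 \<le> j \<and> j \<le> min k (m - 1) \<longrightarrow> take (m - j) (\<omega> k) = drop j (\<omega> (k - j)))"

definition totally_distinct :: "nat \<Rightarrow> (nat \<Rightarrow> nat list) \<Rightarrow> nat \<Rightarrow> bool" where
  "totally_distinct m \<omega> k \<longleftrightarrow>
     (\<forall>j. 1 \<le> j \<and> j \<le> min k (m - 1) \<longrightarrow> take (m - j) (\<omega> k) \<noteq> drop j (\<omega> (k - j)))"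

definition L_set :: "nat \<Rightarrow> nat \<Rightarrow> nat \<Rightarrow> nat \<Rightarrow> (nat \<Rightarrow> nat list) set" where
  "L_set b m p q = {\<omega>. (\<forall>k. \<omega> k \<in> words b m) \<and>
     (\<forall>l. (\<forall>k. l * (p + q) < k \<and> k \<le> l * (p + q) + p \<longrightarrow> progressively_overlapping m \<omega> k) \<and>
          (\<forall>k. l * (p + q) + p < k \<and> k \<le> (l + 1) * (p + q) \<longrightarrow> totally_distinct m \<omega> k))}"

definition is_lambda :: "nat \<Rightarrow> nat \<Rightarrow> real \<Rightarrow> bool" where
  "is_lambda b m x \<longleftrightarrow> x \<in> {real b - 1<..<real b} \<and> pisot x \<and>
     x ^ m - (real b - 1) * (\<Sum>i<m. x ^ i) = 0"

definition is_eta :: "nat \<Rightarrow> nat \<Rightarrow> real \<Rightarrow> bool" where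
  "is_eta b m x \<longleftrightarrow> x \<in> {real b - 1<..<real b} \<and> pisot x \<and>
     x ^ m - real b * x ^ (m - 1) + 1 = 0"

definition dense_in :: "'a::topological_space set \<Rightarrow> 'a set \<Rightarrow> bool" where
  "dense_in S X \<longleftrightarrow> S \<subseteq> X \<and> X \<subseteq> closure S"

end

(* Let N(n) be the number of words of length n avoiding the prescribed word at every position.
   If N(n) is comparable to b^(s n), then K is s-Ahlfors regular: every admissible word u of length n
   has, up to the factor 2^(m-1), as many admissible extensions of length t as there are words of
   length t avoiding the shifted sequence. The reason is that a forbidden word straddling the end of u
   prescribes the first i letters of the extension for some 0 < i < m, prescribing i letters costs a
   factor of at least (b-1)^i >= 2^i, and the 2^(-i) with 0 < i < m sum to less than 1. Hence also
   N(n + t) = N(n) N'(t) up to a constant, N' counting for the shifted sequence.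

   Sorting words by their first forbidden occurrence turns "totally distinct" and "progressively
   overlapping" into two linear recursions for N, so on L_{p,q} the numbers N(n) depend on p and q only.
   As L_{p,q} is invariant under shifts by p + q, the sequence N(l (p + q)) is multiplicative up to a
   constant, which yields lambda_{p,q}. In general eta^n <= N(n) <= C lambda^n, while N grows like
   lambda^n over progressive stretches and like eta^n over totally distinct ones; so lambda_{p,q} equals
   lambda^p eta^q up to a factor independent of p and q, and density follows. *)

theory Submission imports Defs
begin

section \<open>Counting admissible words\<close>

text \<open>Everything rests on \<open>N (k + m) = b * N (k + m - 1) - H k\<close>, where
  \<open>H\<close> counts first hits. Always \<open>H k <= N k\<close>, with equality at totally
  distinct positions; this is the recursion of x^m - b x^(m-1) + 1. Always \<open>N k\<close> is at
  most the sum of the last m values of \<open>H\<close> up to \<open>H k\<close>, with equality at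
  progressively overlapping positions; telescoping turns this into the recursion of x^m -
  (b-1)(x^(m-1) + ... + 1). The two kinds of position are thus the extremes of one pair of
  inequalities, which is why eta and lambda bound the growth for every sequence. The recursions
  alternate along a sequence and are never solved: each is compared, by induction, with powers of
  its root in (b-1, b). The end needs two kinds of precision. Density needs constants independent of
  p and q, whereas lying in the interval needs eta^(p+q) <= \<Lambda> <= lambda^(p+q) with no
  constant at all, which is obtained by taking high powers. The bounds on Hausdorff measure come
  from counting cylinders that meet a ball, so no measure on K is constructed.\<close>

definition shifted :: "nat \<Rightarrow> (nat \<Rightarrow> 'a) \<Rightarrow> nat \<Rightarrow> 'a" where
  "shifted n \<omega> = (\<lambda>k. \<omega> (n + k))"

lemma shifted_0 [simp]: "shifted 0 \<omega> = \<omega>"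
  by (simp add: shifted_def)

lemma shifted_shifted [simp]: "shifted i (shifted n \<omega>) = shifted (n + i) \<omega>"
  by (simp add: shifted_def add.assoc)

lemma finite_words [simp]: "finite (words b n)"
  and card_words: "card (words b n) = b ^ n"
proof -
  have "words b n = {xs. set xs \<subseteq> {0..<b} \<and> length xs = n}"
    by (auto simp: words_def)
  then show "finite (words b n)" "card (words b n) = b ^ n"
    using finite_lists_length_eq[of "{0..<b}" n] card_lists_length_eq[of "{0..<b}" n] by auto
qed

lemma in_words_append: "length u = n \<Longrightarrow> u @ v \<in> words b (n + t) \<longleftrightarrow> u \<in> words b n \<and> v \<in> words b t"
  by (auto simp: words_def)

locale forbidden_words =
  fixes b m :: nat
  assumes b_ge: "b \<ge> 3" and m_ge: "m \<ge> 2"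
begin

definition adm :: "(nat \<Rightarrow> nat list) \<Rightarrow> nat \<Rightarrow> nat list set" where
  "adm \<omega> n = {w \<in> words b n. \<forall>k. k + m \<le> n \<longrightarrow> take m (drop k w) \<noteq> \<omega> k}"

definition first_hit :: "(nat \<Rightarrow> nat list) \<Rightarrow> nat \<Rightarrow> nat list set" where
  "first_hit \<omega> k = {w \<in> words b (k + m). (\<forall>j<k. take m (drop j w) \<noteq> \<omega> j) \<and> drop k w = \<omega> k}"

abbreviation N :: "(nat \<Rightarrow> nat list) \<Rightarrow> nat \<Rightarrow> nat" where
  "N \<omega> n \<equiv> card (adm \<omega> n)"

abbreviation H :: "(nat \<Rightarrow> nat list) \<Rightarrow> nat \<Rightarrow> nat" where
  "H \<omega> k \<equiv> card (first_hit \<omega> k)"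

lemma finite_adm [simp]: "finite (adm \<omega> n)"
  by (rule finite_subset[OF _ finite_words[of b n]]) (auto simp: adm_def)

lemma finite_first_hit [simp]: "finite (first_hit \<omega> k)"
  by (rule finite_subset[OF _ finite_words[of b "k + m"]]) (auto simp: first_hit_def)

lemma length_adm: "w \<in> adm \<omega> n \<Longrightarrow> length w = n"
  by (simp add: adm_def words_def)

lemma N_small: "n < m \<Longrightarrow> N \<omega> n = b ^ n"
  by (simp add: adm_def card_words[symmetric])

lemma adm_append:
  assumes "length u = n" and "u @ v \<in> adm \<omega> (n + t)"
  shows "u \<in> adm \<omega> n" and "v \<in> adm (shifted n \<omega>) t"
proof -
  have w: "u \<in> words b n" "v \<in> words b t"
    using assms in_words_append[of u n v b t] by (auto simp: adm_def)
  have a: "take m (drop k (u @ v)) \<noteq> \<omega> k" if "k + m \<le> n + t" for k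
    using assms that by (simp add: adm_def)
  show "u \<in> adm \<omega> n"
  proof -
    have "take m (drop k u) \<noteq> \<omega> k" if "k + m \<le> n" for k
      using a[of k] that assms(1) by simp
    then show ?thesis using w by (simp add: adm_def)
  qed
  show "v \<in> adm (shifted n \<omega>) t"
  proof -
    have "take m (drop k v) \<noteq> \<omega> (n + k)" if "k + m \<le> t" for k
      using a[of "n + k"] that assms(1) by simp
    then show ?thesis using w by (simp add: adm_def shifted_def)
  qed
qed

lemma take_adm: "w \<in> adm \<omega> n \<Longrightarrow> l \<le> n \<Longrightarrow> take l w \<in> adm \<omega> l"
  and drop_adm: "w \<in> adm \<omega> n \<Longrightarrow> l \<le> n \<Longrightarrow> drop l w \<in> adm (shifted l \<omega>) (n - l)"
  using adm_append[of "take l w" l "drop l w" \<omega> "n - l"] length_adm[of w \<omega> n] by auto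

section \<open>First-hit recursion and its two extreme cases\<close>

text \<open>Appending a letter to an admissible word of length \<open>k + m - 1\<close> creates a
  single new window, the one at \<open>k\<close>. The result is therefore either admissible or a
  first hit at \<open>k\<close>, and each of those arises exactly once.\<close>

lemma N_step: "H \<omega> k + N \<omega> (k + m) = b * N \<omega> (k + m - 1)"
proof -
  define n where "n = k + m - 1"
  have n: "k + m = n + 1" using m_ge by (simp add: n_def)
  have key: "(\<forall>j<k. take m (drop j (u @ [a])) \<noteq> \<omega> j) \<longleftrightarrow> (\<forall>j. j + m \<le> n \<longrightarrow> take m (drop j u) \<noteq> \<omega> j)"
    if "length u = n" for u a
  proof -
    have "j < k \<longleftrightarrow> j + m \<le> n" for j using n by auto
    then show ?thesis using that by auto
  qed
  have step: "u @ [a] \<in> first_hit \<omega> k \<union> adm \<omega> (k + m) \<longleftrightarrow> u \<in> adm \<omega> n \<and> a < b"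
    if u: "length u = n" for u a
  proof -
    have w: "u @ [a] \<in> words b (k + m) \<longleftrightarrow> u \<in> words b n \<and> a < b"
      unfolding n using u by (auto simp: words_def)
    have "(\<forall>j. j + m \<le> k + m \<longrightarrow> take m (drop j (u @ [a])) \<noteq> \<omega> j) \<longleftrightarrow>
        (\<forall>j<k. take m (drop j (u @ [a])) \<noteq> \<omega> j) \<and> drop k (u @ [a]) \<noteq> \<omega> k"
    proof -
      have "take m (drop k (u @ [a])) = drop k (u @ [a])"
        by (rule take_all) (use u n in auto)
      then show ?thesis by (metis add_le_cancel_right le_neq_implies_less less_or_eq_imp_le)
    qed
    then show ?thesis
      unfolding first_hit_def adm_def using w key[OF u, of a] by blast
  qed
  have "(\<lambda>(u, a). u @ [a]) ` (adm \<omega> n \<times> {0..<b}) = first_hit \<omega> k \<union> adm \<omega> (k + m)" (is "?f ` ?A = ?B")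
  proof
    show "?f ` ?A \<subseteq> ?B"
    proof (rule image_subsetI)
      fix p assume "p \<in> ?A"
      then obtain u a where "p = (u, a)" "u \<in> adm \<omega> n" "a < b" by auto
      then show "?f p \<in> ?B" using step[of u a] length_adm[of u \<omega> n] by simp
    qed
    show "?B \<subseteq> ?f ` ?A"
    proof
      fix w assume w: "w \<in> ?B"
      then have "length w = n + 1" using n by (auto simp: first_hit_def adm_def words_def)
      then obtain u a where "w = u @ [a]" "length u = n"
        by (metis Suc_eq_plus1 length_Suc_conv_rev)
      then show "w \<in> ?f ` ?A" using w step[of u a] by force
    qed
  qed
  moreover have "inj_on (\<lambda>(u, a). u @ [a]) (adm \<omega> n \<times> {0..<b})"
    by (auto simp: inj_on_def)
  ultimately have "card (first_hit \<omega> k \<union> adm \<omega> (k + m)) = N \<omega> n * b"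
    using card_image[of ?f ?A] by (simp add: card_cartesian_product)
  moreover have "first_hit \<omega> k \<inter> adm \<omega> (k + m) = {}"
  proof -
    have "take m (drop k w) = drop k w" if "w \<in> words b (k + m)" for w
      using that by (simp add: words_def)
    then show ?thesis unfolding first_hit_def adm_def by fastforce
  qed
  ultimately show ?thesis
    using card_Un_disjoint[of "first_hit \<omega> k" "adm \<omega> (k + m)"] by (simp add: n_def)
qed

lemma first_hitD:
  assumes "w \<in> first_hit \<omega> k" and "i < m"
  shows "take (k + i) w \<in> adm \<omega> (k + i)"
proof -
  have w: "w \<in> words b (k + m)" and h: "\<And>j. j < k \<Longrightarrow> take m (drop j w) \<noteq> \<omega> j"
    using assms by (auto simp: first_hit_def)
  have "take (k + i) w \<in> words b (k + i)"
    using w assms(2) by (auto simp: words_def dest: in_set_takeD)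
  moreover have "take m (drop j (take (k + i) w)) \<noteq> \<omega> j" if "j + m \<le> k + i" for j
  proof -
    have "take m (drop j (take (k + i) w)) = take m (drop j w)"
      using that by (simp add: drop_take min_def)
    then show ?thesis using h[of j] that assms(2) by auto
  qed
  ultimately show ?thesis by (simp add: adm_def)
qed

lemma first_hit_eq_append: "w \<in> first_hit \<omega> k \<Longrightarrow> w = take k w @ \<omega> k"
  by (simp add: first_hit_def) (metis append_take_drop_id)

text \<open>A first hit at \<open>k\<close> ends in \<open>\<omega> k\<close>, so its first
  \<open>k\<close> letters determine it, and these form an admissible word.\<close>

lemma H_le_N: "H \<omega> k \<le> N \<omega> k"
proof (rule card_inj_on_le[of "take k"])
  show "inj_on (take k) (first_hit \<omega> k)"
    by (rule inj_onI) (metis first_hit_eq_append)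
  show "take k ` first_hit \<omega> k \<subseteq> adm \<omega> k"
    using first_hitD[of _ \<omega> k 0] m_ge by auto
qed simp

text \<open>Appending \<open>\<omega> k\<close> to an admissible word of length \<open>k\<close>
  always gives a first hit: an earlier forbidden occurrence would have to overlap the appended
  block, and total distinctness rules out each possible overlap.\<close>

lemma H_eq_N_if_totally_distinct:
  assumes \<omega>: "\<omega> k \<in> words b m" and td: "totally_distinct m \<omega> k"
  shows "H \<omega> k = N \<omega> k"
proof (rule antisym[OF H_le_N])
  show "N \<omega> k \<le> H \<omega> k"
  proof (rule card_inj_on_le[of "\<lambda>u. u @ \<omega> k"])
    show "(\<lambda>u. u @ \<omega> k) ` adm \<omega> k \<subseteq> first_hit \<omega> k"
    proof clarify
      fix u assume u: "u \<in> adm \<omega> k"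
      have lu: "length u = k" and lo: "length (\<omega> k) = m"
        using u \<omega> by (auto simp: adm_def words_def)
      have "take m (drop j (u @ \<omega> k)) \<noteq> \<omega> j" if j: "j < k" for j
      proof (cases "j + m \<le> k")
        case True
        then show ?thesis using u lu by (simp add: adm_def)
      next
        case False
        \<comment> \<open>The occurrence at \<open>j\<close> would cover the first
          \<open>m - i\<close> letters of \<open>\<omega> k\<close>.\<close>
        define i where "i = k - j"
        have i: "1 \<le> i" "i \<le> min k (m - 1)" "j = k - i" using False j by (auto simp: i_def)
        have e: "take m (drop j (u @ \<omega> k)) = drop j u @ take (m - i) (\<omega> k)"
          using lu i False by simp
        show ?thesis
        proof
          assume "take m (drop j (u @ \<omega> k)) = \<omega> j"
          moreover have "drop i (drop j u @ take (m - i) (\<omega> k)) = take (m - i) (\<omega> k)"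
            using i lu by simp
          ultimately have "drop i (\<omega> (k - i)) = take (m - i) (\<omega> k)"
            using e i(3) by metis
          then show False using td i unfolding totally_distinct_def by metis
        qed
      qed
      moreover have "u @ \<omega> k \<in> words b (k + m)"
        using u \<omega> lu by (simp add: in_words_append adm_def)
      ultimately show "u @ \<omega> k \<in> first_hit \<omega> k" using lu by (simp add: first_hit_def)
    qed
  qed (auto simp: inj_on_def)
qed

text \<open>Append \<open>\<omega> k\<close> to an admissible \<open>u\<close> of length
  \<open>k\<close>. The first forbidden occurrence in the result starts at most \<open>m - 1\<close>
  places before \<open>k\<close>, as none lies inside \<open>u\<close>. Cutting right after it gives
  a first hit that has \<open>u\<close> as its prefix of length \<open>k\<close>.\<close>

lemma N_le_sum_H:
  assumes \<omega>: "\<And>k. \<omega> k \<in> words b m"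
  shows "N \<omega> k \<le> (\<Sum>i\<le>min k (m - 1). H \<omega> (k - i))"
proof -
  have "adm \<omega> k \<subseteq> (\<Union>i\<le>min k (m - 1). take k ` first_hit \<omega> (k - i))"
  proof
    fix u assume u: "u \<in> adm \<omega> k"
    define w where "w = u @ \<omega> k"
    have lu: "length u = k" and lo: "length (\<omega> j) = m" for j
      using u \<omega>[of j] by (auto simp: adm_def words_def)
    have ww: "w \<in> words b (k + m)"
      using u \<omega> lu by (simp add: w_def in_words_append adm_def)
    define j where "j = (LEAST j. take m (drop j w) = \<omega> j)"
    have ex: "take m (drop k w) = \<omega> k" using lu lo by (simp add: w_def)
    have j: "take m (drop j w) = \<omega> j" and jk: "j \<le> k"
      using LeastI[of "\<lambda>j. take m (drop j w) = \<omega> j", OF ex] Least_le[of "\<lambda>j. take m (drop j w) = \<omega> j", OF ex]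
      by (auto simp: j_def)
    have nj: "take m (drop i w) \<noteq> \<omega> i" if "i < j" for i
      using not_less_Least[of i "\<lambda>j. take m (drop j w) = \<omega> j"] that by (simp add: j_def)
    have jm: "k < j + m"
    proof (rule ccontr)
      assume "\<not> k < j + m"
      then have "take m (drop j u) = \<omega> j" using j lu by (simp add: w_def)
      then show False using u \<open>\<not> k < j + m\<close> by (simp add: adm_def)
    qed
    have "take (j + m) w \<in> first_hit \<omega> j"
    proof -
      have "take (j + m) w \<in> words b (j + m)"
        using ww jk by (auto simp: words_def dest: in_set_takeD)
      moreover have "take m (drop i (take (j + m) w)) = take m (drop i w)" if "i < j" for i
        using that by (simp add: drop_take min_def)
      moreover have "drop j (take (j + m) w) = \<omega> j" using j by (simp add: drop_take)
      ultimately show ?thesis using nj by (simp add: first_hit_def)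
    qed
    moreover have "u = take k (take (j + m) w)"
      using jm lu by (simp add: w_def min_def)
    moreover have "k - j \<le> min k (m - 1)" "k - (k - j) = j" using jm jk by auto
    ultimately show "u \<in> (\<Union>i\<le>min k (m - 1). take k ` first_hit \<omega> (k - i))"
      by (metis UN_I atMost_iff image_eqI)
  qed
  then have "N \<omega> k \<le> card (\<Union>i\<le>min k (m - 1). take k ` first_hit \<omega> (k - i))"
    by (intro card_mono) auto
  also have "\<dots> \<le> (\<Sum>i\<le>min k (m - 1). card (take k ` first_hit \<omega> (k - i)))"
    by (rule card_UN_le) simp
  also have "\<dots> \<le> (\<Sum>i\<le>min k (m - 1). H \<omega> (k - i))"
    by (intro sum_mono card_image_le) simp
  finally show ?thesis .
qed

text \<open>Cutting first hits at \<open>k - i\<close> down to length \<open>k\<close> maps into the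
  admissible words. Overlapping makes this injective, even across different \<open>i\<close>,
  because the cut hit can be recovered by appending \<open>\<omega> k\<close>.\<close>

lemma N_eq_sum_H_if_progressively_overlapping:
  assumes \<omega>: "\<And>k. \<omega> k \<in> words b m" and po: "progressively_overlapping m \<omega> k"
  shows "N \<omega> k = (\<Sum>i\<le>min k (m - 1). H \<omega> (k - i))"
proof (rule antisym[OF N_le_sum_H[OF \<omega>]])
  let ?I = "{..min k (m - 1)}"
  let ?S = "SIGMA i:?I. first_hit \<omega> (k - i)"
  have lo: "length (\<omega> j) = m" for j using \<omega>[of j] by (auto simp: words_def)
  \<comment> \<open>The letters cut off are the first \<open>m - i\<close> letters of
    \<open>\<omega> k\<close>, by the overlap of \<open>\<omega> (k - i)\<close> with
    \<open>\<omega> k\<close>.\<close>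
  have ext: "h = take (k - i + m) (take k h @ \<omega> k)" if "i \<in> ?I" "h \<in> first_hit \<omega> (k - i)" for i h
  proof -
    have i: "i \<le> k" "i < m" using that m_ge by auto
    have lh: "length h = k - i + m" using that by (simp add: first_hit_def words_def)
    have "drop k h = drop i (drop (k - i) h)" using i by simp
    also have "\<dots> = drop i (\<omega> (k - i))" using that by (simp add: first_hit_def)
    also have "\<dots> = take (m - i) (\<omega> k)"
      using po i lo by (cases "i = 0") (auto simp: progressively_overlapping_def)
    finally have "h = take k h @ take (m - i) (\<omega> k)" by (metis append_take_drop_id)
    moreover have "k \<le> length h" "k - i + m - k = m - i" "min (k - i + m) k = k" using i lh by auto
    ultimately show ?thesis by simp
  qed
  \<comment> \<open>Both hits are prefixes of the same word. The one that ends later therefore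
    contains the earlier occurrence, at \<open>k - i'\<close>, and is not a first hit at
    \<open>k - i\<close>.\<close>
  have le: "False" if ih: "i \<in> ?I" "h \<in> first_hit \<omega> (k - i)" and ih': "i' \<in> ?I" "h' \<in> first_hit \<omega> (k - i')"
    and eq: "take k h = take k h'" and less: "i < i'" for i h i' h'
  proof -
    define j where "j = k - i'"
    have j: "j < k - i" using ih ih' less by (auto simp: j_def)
    define w where "w = take k h @ \<omega> k"
    have h: "h = take (k - i + m) w" and h': "h' = take (j + m) w"
      using ext[OF ih] ext[OF ih'] eq by (auto simp: w_def j_def)
    have "take m (drop j h) = take m (drop j w)" unfolding h using j by (simp add: drop_take min_def)
    moreover have "take m (drop j w) = drop j h'" unfolding h' by (simp add: drop_take)
    moreover have "drop j h' = \<omega> j" using ih' by (simp add: first_hit_def j_def)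
    ultimately show False using ih j by (auto simp: first_hit_def)
  qed
  have "inj_on (\<lambda>(i, h). take k h) ?S"
  proof (rule inj_onI)
    fix p p' assume pp: "p \<in> ?S" "p' \<in> ?S" "(\<lambda>(i, h). take k h) p = (\<lambda>(i, h). take k h) p'"
    obtain i h i' h' where p: "p = (i, h)" "p' = (i', h')" by fastforce
    have a: "i \<in> ?I" "h \<in> first_hit \<omega> (k - i)" "i' \<in> ?I" "h' \<in> first_hit \<omega> (k - i')"
      and eq: "take k h = take k h'" using pp p by auto
    have "i = i'" using le[OF a(1,2) a(3,4) eq] le[OF a(3,4) a(1,2) eq[symmetric]]
      by (meson linorder_neqE_nat)
    then show "p = p'" using ext[OF a(1,2)] ext[OF a(3,4)] eq p by metis
  qed
  moreover have "(\<lambda>(i, h). take k h) ` ?S \<subseteq> adm \<omega> k"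
  proof (rule image_subsetI)
    fix p assume "p \<in> ?S"
    then obtain i h where p: "p = (i, h)" "i \<in> ?I" "h \<in> first_hit \<omega> (k - i)" by auto
    then have "i < m" "k - i + i = k" using m_ge by auto
    then show "(\<lambda>(i, h). take k h) p \<in> adm \<omega> k" using first_hitD[OF p(3), of i] p(1) by simp
  qed
  ultimately have "card ?S \<le> N \<omega> k" by (intro card_inj_on_le[of "\<lambda>(i, h). take k h"]) auto
  then show "(\<Sum>i\<in>?I. H \<omega> (k - i)) \<le> N \<omega> k" by (simp add: card_SigmaI)
qed

section \<open>Multiplicativity of the counts up to a constant\<close>

text \<open>A new first letter other than the first letter of \<open>\<omega> 0\<close> cannot
  create an occurrence at position 0, which leaves at least \<open>b - 1\<close> choices.\<close>

lemma N_shifted_1: "(b - 1) * N (shifted 1 \<omega>) n \<le> N \<omega> (Suc n)"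
proof -
  let ?A = "({0..<b} - {\<omega> 0 ! 0}) \<times> adm (shifted 1 \<omega>) n"
  have "(\<lambda>(a, v). a # v) ` ?A \<subseteq> adm \<omega> (Suc n)"
  proof (rule image_subsetI)
    fix p assume "p \<in> ?A"
    then obtain a v where p: "p = (a, v)" and a: "a \<in> {0..<b}" "a \<noteq> \<omega> 0 ! 0"
      and v: "v \<in> adm (shifted 1 \<omega>) n" by blast
    have "take m (drop k (a # v)) \<noteq> \<omega> k" if "k + m \<le> Suc n" for k
    proof (cases k)
      case 0
      have "take m (drop 0 (a # v)) ! 0 = a" using m_ge by simp
      then show ?thesis using a 0 by auto
    next
      case (Suc k')
      then show ?thesis using v that by (simp add: adm_def shifted_def)
    qed
    then show "(\<lambda>(a, v). a # v) p \<in> adm \<omega> (Suc n)" using a v p by (auto simp: adm_def words_def)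
  qed
  then have "card ?A \<le> N \<omega> (Suc n)"
    by (intro card_inj_on_le[of "\<lambda>(a, v). a # v"]) (auto simp: inj_on_def)
  moreover have "b - 1 \<le> card ({0..<b} - {\<omega> 0 ! 0})"
    using diff_card_le_card_Diff[of "{\<omega> 0 ! 0}" "{0..<b}"] by simp
  ultimately show ?thesis
    by (metis card_cartesian_product le_trans mult_le_mono1)
qed

lemma N_shifted: "2 ^ i * N (shifted i \<omega>) n \<le> N \<omega> (n + i)"
proof (induction i arbitrary: n)
  case (Suc i)
  have "2 * N (shifted 1 (shifted i \<omega>)) n \<le> (b - 1) * N (shifted 1 (shifted i \<omega>)) n"
    using b_ge by (intro mult_right_mono) auto
  also have "\<dots> \<le> N (shifted i \<omega>) (Suc n)" by (rule N_shifted_1)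
  finally have "2 ^ i * (2 * N (shifted (Suc i) \<omega>) n) \<le> 2 ^ i * N (shifted i \<omega>) (Suc n)"
    by simp
  also have "\<dots> \<le> N \<omega> (Suc n + i)" by (rule Suc.IH)
  finally show ?case by (simp add: mult.assoc mult.left_commute)
qed simp

lemma N_submult: "N \<omega> (n + t) \<le> N \<omega> n * N (shifted n \<omega>) t"
proof -
  have "N \<omega> (n + t) \<le> card (adm \<omega> n \<times> adm (shifted n \<omega>) t)"
  proof (rule card_inj_on_le[of "\<lambda>w. (take n w, drop n w)"])
    show "inj_on (\<lambda>w. (take n w, drop n w)) (adm \<omega> (n + t))"
      by (rule inj_onI) (metis append_take_drop_id prod.inject)
    show "(\<lambda>w. (take n w, drop n w)) ` adm \<omega> (n + t) \<subseteq> adm \<omega> n \<times> adm (shifted n \<omega>) t"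
      using take_adm[of _ \<omega> "n + t" n] drop_adm[of _ \<omega> "n + t" n] by auto
  qed simp
  then show ?thesis by (simp add: card_cartesian_product)
qed

definition extensions :: "(nat \<Rightarrow> nat list) \<Rightarrow> nat list \<Rightarrow> nat \<Rightarrow> nat list set" where
  "extensions \<omega> u t = {v. u @ v \<in> adm \<omega> (length u + t)}"

lemma extensions_subset: "extensions \<omega> u t \<subseteq> adm (shifted (length u) \<omega>) t"
  using adm_append(2)[of u] by (auto simp: extensions_def)

lemma finite_extensions [simp]: "finite (extensions \<omega> u t)"
  using extensions_subset finite_adm by (rule finite_subset)

lemma card_adm_with_prefix_le:
  assumes "i \<le> t"
  shows "2 ^ i * card {v \<in> adm \<omega> t. take i v = c} \<le> N \<omega> t"
proof -
  have "card {v \<in> adm \<omega> t. take i v = c} \<le> N (shifted i \<omega>) (t - i)"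
  proof (rule card_inj_on_le[of "drop i"])
    show "inj_on (drop i) {v \<in> adm \<omega> t. take i v = c}"
      by (rule inj_onI) (metis (mono_tags, lifting) append_take_drop_id mem_Collect_eq)
  qed (use drop_adm assms in auto)
  then have "2 ^ i * card {v \<in> adm \<omega> t. take i v = c} \<le> 2 ^ i * N (shifted i \<omega>) (t - i)" by simp
  also have "\<dots> \<le> N \<omega> (t - i + i)" by (rule N_shifted)
  finally show ?thesis using assms by simp
qed

lemma N_le_extensions:
  assumes u: "u \<in> adm \<omega> n"
  shows "N (shifted n \<omega>) t \<le> 2 ^ (m - 1) * card (extensions \<omega> u t)"
proof -
  let ?A = "adm (shifted n \<omega>) t"
  let ?I = "{i \<in> {1..<m}. i \<le> t}"
  \<comment> \<open>Words that start with the last \<open>i\<close> letters of the forbidden word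
    straddling the end of \<open>u\<close>. Its position is \<open>n + i - m\<close>. If
    \<open>n + i < m\<close>, the subtraction truncates and the set is spurious but harmless, since
    the bound on its size holds for any prescribed prefix.\<close>
  let ?T = "\<lambda>i. {v \<in> ?A. take i v = drop (m - i) (\<omega> (n + i - m))}"
  have lu: "length u = n" using u by (rule length_adm)
  have "?A - extensions \<omega> u t \<subseteq> (\<Union>i\<in>?I. ?T i)"
  proof
    fix v assume v: "v \<in> ?A - extensions \<omega> u t"
    then have lv: "length v = t" using length_adm by blast
    have "u @ v \<in> words b (n + t)" using u v lu by (simp add: in_words_append adm_def)
    then obtain k where k: "k + m \<le> n + t" "take m (drop k (u @ v)) = \<omega> k"
      using v lu by (auto simp: extensions_def adm_def)
    have k1: "n < k + m"
    proof (rule ccontr)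
      assume "\<not> n < k + m"
      then show False using k u lu by (simp add: adm_def)
    qed
    have k2: "k < n"
    proof (rule ccontr)
      assume "\<not> k < n"
      then have "take m (drop (k - n) v) = shifted n \<omega> (k - n)" and "k - n + m \<le> t"
        using k lu by (auto simp: shifted_def)
      then show False using v by (simp add: adm_def)
    qed
    define i where "i = k + m - n"
    have i: "i \<in> ?I" "n + i - m = k" using k k1 k2 by (auto simp: i_def)
    have "drop (m - i) (\<omega> k) = take i v"
    proof -
      have "take m (drop k (u @ v)) = drop k u @ take i v" using k1 k2 lu by (simp add: i_def add.commute)
      moreover have "length (drop k u) = m - i" using lu k1 k2 by (simp add: i_def)
      ultimately show ?thesis using k by (metis append_eq_conv_conj)
    qed
    then show "v \<in> (\<Union>i\<in>?I. ?T i)" using i v by auto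
  qed
  then have "card (?A - extensions \<omega> u t) \<le> card (\<Union>i\<in>?I. ?T i)"
    by (intro card_mono) auto
  also have "\<dots> \<le> (\<Sum>i\<in>?I. card (?T i))" by (rule card_UN_le) simp
  finally have 1: "N (shifted n \<omega>) t - card (extensions \<omega> u t) \<le> (\<Sum>i\<in>?I. card (?T i))"
    using extensions_subset[of \<omega> u t] lu by (simp add: card_Diff_subset)
  have "real (N (shifted n \<omega>) t) \<le> card (extensions \<omega> u t) + (\<Sum>i\<in>?I. real (card (?T i)))"
    using 1 by (simp flip: of_nat_sum of_nat_add)
  also have "(\<Sum>i\<in>?I. real (card (?T i))) \<le> (\<Sum>i\<in>?I. real (N (shifted n \<omega>) t) / 2 ^ i)"
  proof (rule sum_mono)
    fix i assume "i \<in> ?I"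
    then have "2 ^ i * card (?T i) \<le> N (shifted n \<omega>) t"
      using card_adm_with_prefix_le by auto
    then have "real (2 ^ i * card (?T i)) \<le> real (N (shifted n \<omega>) t)"
      by (simp only: of_nat_le_iff)
    then show "real (card (?T i)) \<le> real (N (shifted n \<omega>) t) / 2 ^ i"
      by (simp add: field_simps)
  qed
  also have "\<dots> \<le> (\<Sum>i\<in>{1..<m}. real (N (shifted n \<omega>) t) / 2 ^ i)"
    by (rule sum_mono2) auto
  also have "\<dots> = real (N (shifted n \<omega>) t) * (\<Sum>i\<in>{1..<m}. 1 / 2 ^ i)"
    by (simp add: sum_distrib_left)
  \<comment> \<open>The deficit of this sum from 1 is the fraction of words that certainly extend
    \<open>u\<close>; its reciprocal is the constant \<open>2 ^ (m - 1)\<close>.\<close>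
  also have "(\<Sum>i\<in>{1..<m}. 1 / 2 ^ i :: real) = 1 - 1 / 2 ^ (m - 1)"
  proof -
    have "(\<Sum>i\<in>{1..<Suc j}. 1 / 2 ^ i :: real) = 1 - 1 / 2 ^ j" for j
      by (induction j) (auto simp: field_simps)
    from this[of "m - 1"] show ?thesis using m_ge by simp
  qed
  finally have "real (N (shifted n \<omega>) t) / 2 ^ (m - 1) \<le> card (extensions \<omega> u t)"
    by (simp add: algebra_simps)
  then have "real (N (shifted n \<omega>) t) \<le> real (2 ^ (m - 1) * card (extensions \<omega> u t))"
    by (simp add: field_simps)
  then show ?thesis by (simp only: of_nat_le_iff)
qed

lemma N_supermult: "N \<omega> n * N (shifted n \<omega>) t \<le> 2 ^ (m - 1) * N \<omega> (n + t)"
proof -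
  have "N \<omega> n * N (shifted n \<omega>) t = (\<Sum>u\<in>adm \<omega> n. N (shifted n \<omega>) t)" by simp
  also have "\<dots> \<le> (\<Sum>u\<in>adm \<omega> n. 2 ^ (m - 1) * card (extensions \<omega> u t))"
    by (intro sum_mono N_le_extensions)
  also have "\<dots> = 2 ^ (m - 1) * card (SIGMA u:adm \<omega> n. extensions \<omega> u t)"
    by (simp add: sum_distrib_left card_SigmaI)
  also have "card (SIGMA u:adm \<omega> n. extensions \<omega> u t) \<le> N \<omega> (n + t)"
  proof (rule card_inj_on_le[of "\<lambda>(u, v). u @ v"])
    show "inj_on (\<lambda>(u, v). u @ v) (SIGMA u:adm \<omega> n. extensions \<omega> u t)"
    proof (rule inj_onI, clarify)
      fix u v u' v'
      assume "u \<in> adm \<omega> n" "u' \<in> adm \<omega> n" "u @ v = u' @ v'"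
      then show "u = u' \<and> v = v'" using length_adm[of u \<omega> n] length_adm[of u' \<omega> n] by simp
    qed
  qed (auto simp: extensions_def dest: length_adm)
  finally show ?thesis by simp
qed

end

section \<open>Growth of the number of admissible words\<close>

text \<open>A two-sided Fekete lemma: with both inequalities available, \<open>g\<close> stays
  within a bounded distance of a linear function, instead of merely having a limiting slope.\<close>

lemma quasi_additive_bounds:
  fixes g :: "nat \<Rightarrow> real"
  assumes sub: "\<And>k l. g (k + l) \<le> g k + g l" and sup: "\<And>k l. g k + g l \<le> g (k + l) + c"
  shows "\<exists>\<theta>. \<forall>l. \<theta> * l \<le> g l \<and> g l \<le> \<theta> * l + c"
proof -
  have g0: "0 \<le> g 0" "g 0 \<le> c" using sub[of 0 0] sup[of 0 0] by auto
  have up: "g (Suc k * l) \<le> Suc k * g l" for k l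
  proof (induction k)
    case (Suc k)
    then show ?case using sub[of l "Suc k * l"] by (simp add: algebra_simps)
  qed simp
  have lo: "Suc k * g l \<le> g (Suc k * l) + k * c" for k l
  proof (induction k)
    case (Suc k)
    then show ?case using sup[of l "Suc k * l"] by (simp add: algebra_simps)
  qed simp
  \<comment> \<open>Estimating \<open>g\<close> at the product of the two arguments in both ways
    puts every lower quotient below every upper quotient, so their supremum separates them.\<close>
  have le: "(g (Suc k) - c) / Suc k \<le> g (Suc l) / Suc l" for k l
  proof -
    have "Suc l * g (Suc k) \<le> Suc k * g (Suc l) + l * c"
      using lo[of l "Suc k"] up[of k "Suc l"] by (simp add: algebra_simps)
    then show ?thesis using g0 by (simp add: field_simps)
  qed
  define \<theta> where "\<theta> = (SUP k. (g (Suc k) - c) / Suc k)"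
  have bdd: "bdd_above (range (\<lambda>k. (g (Suc k) - c) / Suc k))"
    using le[of _ 0] by (auto simp: bdd_above_def)
  have 1: "(g (Suc k) - c) / Suc k \<le> \<theta>" for k
    unfolding \<theta>_def by (rule cSUP_upper[OF _ bdd]) simp
  have 2: "\<theta> \<le> g (Suc l) / Suc l" for l
    unfolding \<theta>_def by (rule cSUP_least) (use le in auto)
  have "\<theta> * l \<le> g l \<and> g l \<le> \<theta> * l + c" for l
  proof (cases l)
    case 0
    then show ?thesis using g0 by simp
  next
    case (Suc k)
    then show ?thesis using 1[of k] 2[of k] by (simp add: field_simps)
  qed
  then show ?thesis by blast
qed

text \<open>The ratio \<open>x / y\<close> has bounded powers, so it cannot exceed 1. This removes
  multiplicative constants from growth estimates.\<close>

lemma le_if_powers_le: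
  fixes x y C :: real
  assumes "\<And>n. x ^ n \<le> C * y ^ n" and "y > 0"
  shows "x \<le> y"
proof (rule ccontr)
  assume "\<not> x \<le> y"
  then have "1 < x / y" using assms(2) by simp
  then obtain n where "C < (x / y) ^ n" using real_arch_pow by blast
  then show False using assms(1)[of n] assms(2) by (simp add: power_divide field_simps)
qed

lemma progressively_overlapping_shifted:
  "progressively_overlapping m \<omega> (n + k) \<Longrightarrow> progressively_overlapping m (shifted n \<omega>) k"
  by (auto simp: progressively_overlapping_def shifted_def)

lemma totally_distinct_shifted:
  "totally_distinct m \<omega> (n + k) \<Longrightarrow> totally_distinct m (shifted n \<omega>) k"
  by (auto simp: totally_distinct_def shifted_def)

lemma L_setD:
  assumes "\<omega> \<in> L_set b m p q"
  shows "\<omega> k \<in> words b m"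
    and "l * (p + q) < k \<Longrightarrow> k \<le> l * (p + q) + p \<Longrightarrow> progressively_overlapping m \<omega> k"
    and "l * (p + q) + p < k \<Longrightarrow> k \<le> (l + 1) * (p + q) \<Longrightarrow> totally_distinct m \<omega> k"
  using assms by (auto simp: L_set_def)

lemma shifted_in_L_set:
  assumes "\<omega> \<in> L_set b m p q"
  shows "shifted (l * (p + q)) \<omega> \<in> L_set b m p q"
proof -
  have "progressively_overlapping m (shifted (l * (p + q)) \<omega>) k"
    if "l' * (p + q) < k" "k \<le> l' * (p + q) + p" for l' k
    by (rule progressively_overlapping_shifted, rule L_setD(2)[OF assms, of "l + l'"]) (use that in \<open>auto simp: algebra_simps\<close>)
  moreover have "totally_distinct m (shifted (l * (p + q)) \<omega>) k"
    if "l' * (p + q) + p < k" "k \<le> (l' + 1) * (p + q)" for l' k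
    by (rule totally_distinct_shifted, rule L_setD(3)[OF assms, of "l + l'"]) (use that in \<open>auto simp: algebra_simps\<close>)
  moreover have "shifted (l * (p + q)) \<omega> k \<in> words b m" for k
    using L_setD(1)[OF assms] by (simp add: shifted_def)
  ultimately show ?thesis unfolding L_set_def mem_Collect_eq by blast
qed

text \<open>Periods start at \<open>k = l * (p + q) + 1\<close>, hence the \<open>k - 1\<close>.
  Position 0 falls into the progressive branch, since \<open>0 - 1 = 0\<close> and
  \<open>p >= 1\<close>; there the condition is vacuous.\<close>

lemma L_set_cases:
  assumes "\<omega> \<in> L_set b m p q" and "p \<ge> 1"
  shows "if (k - 1) mod (p + q) < p then progressively_overlapping m \<omega> k else totally_distinct m \<omega> k"
proof (cases k)
  case 0
  then show ?thesis using assms(2) by (simp add: progressively_overlapping_def)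
next
  case (Suc k')
  define l r where "l = k' div (p + q)" and "r = k' mod (p + q)"
  have "k' = l * (p + q) + r" by (simp only: l_def r_def div_mult_mod_eq)
  moreover have "r < p + q" using assms(2) by (simp add: r_def)
  ultimately show ?thesis
    using L_setD(2,3)[OF assms(1), of l k] Suc by (simp add: r_def[symmetric])
qed

context forbidden_words
begin

lemma N_0 [simp]: "N \<omega> 0 = 1"
  using N_small[of 0 \<omega>] m_ge by simp

lemma N_ge_power_2: "2 ^ n \<le> N \<omega> n"
  using N_shifted[of n \<omega> 0] by simp

lemma N_pos: "0 < N \<omega> n"
  using N_ge_power_2[of n \<omega>] by (simp add: order.strict_trans2[of 0 "2 ^ n"])

lemma N_Suc_le: "N \<omega> (Suc n) \<le> b * N \<omega> n"
proof (cases "Suc n < m")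
  case False
  then show ?thesis using N_step[of \<omega> "Suc n - m"] by simp
qed (simp add: N_small)

text \<open>The values \<open>N n\<close> with \<open>n < k + m\<close> involve \<open>H\<close>
  only at positions below \<open>k\<close>, and the type of position \<open>k\<close> then expresses
  \<open>H k\<close> by values already known. Hence the joint induction.\<close>

lemma N_determined_by_types:
  assumes "\<And>k. \<omega> k \<in> words b m" and "\<And>k. \<omega>' k \<in> words b m"
    and type: "\<And>k. progressively_overlapping m \<omega> k \<and> progressively_overlapping m \<omega>' k \<or>
      totally_distinct m \<omega> k \<and> totally_distinct m \<omega>' k"
  shows "N \<omega> n = N \<omega>' n"
proof -
  have "H \<omega> k = H \<omega>' k \<and> (\<forall>n<k + m. N \<omega> n = N \<omega>' n)" for k
  proof (induction k rule: less_induct)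
    case (less k)
    have N: "N \<omega> n = N \<omega>' n" if "n < k + m" for n
    proof (cases "n < m")
      case True
      then show ?thesis by (simp add: N_small)
    next
      case False
      then have "n - m < k" "n - m + m - 1 < n - m + m" "n - m + m = n" using that m_ge by auto
      then show ?thesis
        using less[of "n - m"] N_step[of \<omega> "n - m"] N_step[of \<omega>' "n - m"]
        by (metis add_left_imp_eq)
    qed
    have Nk: "N \<omega> k = N \<omega>' k" using N m_ge by simp
    have "H \<omega> k = H \<omega>' k"
      using type[of k]
    proof
      assume "totally_distinct m \<omega> k \<and> totally_distinct m \<omega>' k"
      then show ?thesis using Nk H_eq_N_if_totally_distinct assms by simp
    next
      assume po: "progressively_overlapping m \<omega> k \<and> progressively_overlapping m \<omega>' k"
      \<comment> \<open>These are the summands with \<open>i >= 1\<close>; the summand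
        \<open>i = 0\<close> is \<open>H k\<close> itself, for which the equation is solved.\<close>
      have "(\<Sum>i<min k (m - 1). H \<omega> (k - Suc i)) = (\<Sum>i<min k (m - 1). H \<omega>' (k - Suc i))"
        by (rule sum.cong) (use less in auto)
      then show ?thesis
        using Nk po N_eq_sum_H_if_progressively_overlapping[where \<omega> = \<omega> and k = k, OF assms(1)]
          N_eq_sum_H_if_progressively_overlapping[where \<omega> = \<omega>' and k = k, OF assms(2)]
        by (simp add: sum.atMost_shift)
    qed
    then show ?case using N by blast
  qed
  from this[of n] show ?thesis using m_ge by simp
qed

lemma N_eq_if_L_set:
  assumes "\<omega> \<in> L_set b m p q" "\<omega>' \<in> L_set b m p q" "p \<ge> 1"
  shows "N \<omega> n = N \<omega>' n"
proof (rule N_determined_by_types)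
  fix k
  show "\<omega> k \<in> words b m" "\<omega>' k \<in> words b m" using assms by (auto simp: L_set_def)
  show "progressively_overlapping m \<omega> k \<and> progressively_overlapping m \<omega>' k \<or>
      totally_distinct m \<omega> k \<and> totally_distinct m \<omega>' k"
    using L_set_cases[OF assms(1,3), of k] L_set_cases[OF assms(2,3), of k] by metis
qed

text \<open>The rate is \<open>exp \<theta>\<close>, with \<theta> the slope of the logarithm of the
  counts at multiples of the period. Additivity up to a constant is available because shifting by
  whole periods does not change the counts.\<close>

lemma L_set_growth:
  assumes "\<omega> \<in> L_set b m p q" "p \<ge> 1"
  shows "\<exists>\<Lambda>>0. \<forall>\<omega>'\<in>L_set b m p q. \<forall>l.
    \<Lambda> ^ l \<le> real (N \<omega>' (l * (p + q))) \<and> real (N \<omega>' (l * (p + q))) \<le> 2 ^ (m - 1) * \<Lambda> ^ l"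
proof -
  define a where "a = (\<lambda>l. real (N \<omega> (l * (p + q))))"
  have a_pos: "a l > 0" for l by (simp add: a_def N_pos)
  have sh: "N (shifted (k * (p + q)) \<omega>) n = N \<omega> n" for k n
    by (rule N_eq_if_L_set) (use assms shifted_in_L_set in auto)
  have "a (k + l) \<le> a k * a l" for k l
    using N_submult[of \<omega> "k * (p + q)" "l * (p + q)"] unfolding a_def sh
    by (simp add: add_mult_distrib flip: of_nat_mult)
  then have sub: "ln (a (k + l)) \<le> ln (a k) + ln (a l)" for k l
    using a_pos by (simp flip: ln_mult_pos)
  have "a k * a l \<le> 2 ^ (m - 1) * a (k + l)" for k l
  proof -
    have "real (N \<omega> (k * (p + q)) * N \<omega> (l * (p + q))) \<le> real (2 ^ (m - 1) * N \<omega> (k * (p + q) + l * (p + q)))"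
      using N_supermult[of \<omega> "k * (p + q)" "l * (p + q)"] unfolding sh of_nat_le_iff .
    then show ?thesis by (simp add: a_def add_mult_distrib)
  qed
  then have sup: "ln (a k) + ln (a l) \<le> ln (a (k + l)) + ln (2 ^ (m - 1))" for k l
    using a_pos by (simp add: mult.commute flip: ln_mult_pos)
  obtain \<theta> where \<theta>: "\<And>l. \<theta> * real l \<le> ln (a l) \<and> ln (a l) \<le> \<theta> * real l + ln (2 ^ (m - 1))"
    using quasi_additive_bounds[of "\<lambda>l. ln (a l)" "ln (2 ^ (m - 1))", OF sub sup] by auto
  have "exp \<theta> ^ l \<le> a l \<and> a l \<le> 2 ^ (m - 1) * exp \<theta> ^ l" for l
  proof
    have "exp (\<theta> * real l) \<le> a l" using \<theta>[of l] a_pos[of l] by (simp add: ln_ge_iff)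
    then show "exp \<theta> ^ l \<le> a l" by (simp add: exp_of_nat_mult[symmetric] mult.commute)
    have "a l \<le> exp (\<theta> * real l + ln (2 ^ (m - 1)))" using \<theta>[of l] a_pos[of l]
      by (metis exp_le_cancel_iff exp_ln)
    then show "a l \<le> 2 ^ (m - 1) * exp \<theta> ^ l"
      by (simp add: exp_of_nat_mult[symmetric] exp_add mult.commute)
  qed
  moreover have "N \<omega>' n = N \<omega> n" if "\<omega>' \<in> L_set b m p q" for \<omega>' n
    by (rule N_eq_if_L_set[OF that assms])
  ultimately show ?thesis unfolding a_def by (intro exI[of _ "exp \<theta>"]) simp
qed

section \<open>Comparison of the counts with powers of lambda and eta\<close>

text \<open>A telescoped sum of \<open>N_step\<close>. Comparing \<open>N k\<close> with the sum of
  \<open>H\<close> on the left now yields the lambda recursion, as an inequality in general and as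
  an equation at progressively overlapping positions.\<close>

lemma N_add_sum_H:
  "real (N \<omega> (k + m)) + (\<Sum>i\<le>min k (m - 1). real (H \<omega> (k - i))) =
    (real b - 1) * (\<Sum>i<m. real (N \<omega> (k + m - Suc i))) + real (N \<omega> k)"
proof -
  define D where "D = (\<lambda>i. real b * N \<omega> (k + m - Suc i) - N \<omega> (k + m - i))"
  have "(\<Sum>i\<le>min k (m - 1). real (H \<omega> (k - i))) = (\<Sum>i\<le>min k (m - 1). D i)"
  proof (rule sum.cong)
    fix i assume "i \<in> {..min k (m - 1)}"
    then have "k - i + m = k + m - i" "k - i + m - 1 = k + m - Suc i" by auto
    then have "real (H \<omega> (k - i) + N \<omega> (k + m - i)) = real (b * N \<omega> (k + m - Suc i))"
      using N_step[of \<omega> "k - i"] by metis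
    then show "real (H \<omega> (k - i)) = D i" by (simp add: D_def)
  qed simp
  \<comment> \<open>The added terms vanish: for \<open>i > k\<close> both counts are at lengths
    below \<open>m\<close>, where all words are admissible.\<close>
  also have "\<dots> = (\<Sum>i<m. D i)"
  proof (rule sum.mono_neutral_left)
    show "\<forall>i\<in>{..<m} - {..min k (m - 1)}. D i = 0"
    proof
      fix i assume "i \<in> {..<m} - {..min k (m - 1)}"
      then have "k + m - i < m" "k + m - i = Suc (k + m - Suc i)" by auto
      then show "D i = 0" unfolding D_def by (simp add: N_small)
    qed
  qed (use m_ge in auto)
  also have "\<dots> = real b * (\<Sum>i<m. real (N \<omega> (k + m - Suc i))) - (\<Sum>i<m. real (N \<omega> (k + m - i)))"
    by (simp add: D_def sum_subtractf sum_distrib_left)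
  also have "(\<Sum>i<m. real (N \<omega> (k + m - i))) =
      real (N \<omega> (k + m)) + (\<Sum>i<m. real (N \<omega> (k + m - Suc i))) - real (N \<omega> k)"
    using sum.lessThan_Suc_shift[of "\<lambda>i. real (N \<omega> (k + m - i))" m]
      sum.lessThan_Suc[of "\<lambda>i. real (N \<omega> (k + m - i))" m] by simp
  finally show ?thesis by (simp add: algebra_simps)
qed

lemma sum_power_lam:
  fixes lam :: real
  assumes lam: "lam ^ m = (real b - 1) * (\<Sum>i<m. lam ^ i)"
  shows "(real b - 1) * (\<Sum>i<m. C * lam ^ (k + m - Suc i)) = C * lam ^ (k + m)"
proof -
  have "(\<Sum>i<m. C * lam ^ (k + m - Suc i)) = (\<Sum>i<m. C * lam ^ k * lam ^ (m - Suc i))"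
    by (rule sum.cong) (auto simp flip: power_add)
  also have "\<dots> = C * lam ^ k * (\<Sum>i<m. lam ^ (m - Suc i))" by (simp add: sum_distrib_left)
  also have "(\<Sum>i<m. lam ^ (m - Suc i)) = (\<Sum>i<m. lam ^ i)" by (rule sum.nat_diff_reindex)
  finally show ?thesis using lam by (simp add: power_add)
qed

lemma N_le_lam:
  fixes lam :: real
  assumes \<omega>: "\<And>k. \<omega> k \<in> words b m" and lam: "lam ^ m = (real b - 1) * (\<Sum>i<m. lam ^ i)" "lam \<ge> 1"
  shows "real (N \<omega> n) \<le> real b ^ m * lam ^ n"
proof (induction n rule: less_induct)
  case (less n)
  show ?case
  proof (cases "n < m")
    case True
    \<comment> \<open>The factor \<open>b ^ m\<close> is there to dominate the initial values
      \<open>b ^ n\<close> with \<open>n < m\<close>; the recursion then preserves the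
      bound.\<close>
    have "real b ^ n * 1 \<le> real b ^ m * lam ^ n"
      using True lam b_ge by (intro mult_mono power_increasing) auto
    then show ?thesis using True by (simp add: N_small)
  next
    case False
    define k where "k = n - m"
    have k: "n = k + m" using False by (simp add: k_def)
    have "real (N \<omega> k) \<le> (\<Sum>i\<le>min k (m - 1). real (H \<omega> (k - i)))"
      using N_le_sum_H[where \<omega> = \<omega> and k = k, OF \<omega>] by (simp flip: of_nat_sum)
    then have "real (N \<omega> n) \<le> (real b - 1) * (\<Sum>i<m. real (N \<omega> (k + m - Suc i)))"
      using N_add_sum_H[of \<omega> k] k by simp
    also have "\<dots> \<le> (real b - 1) * (\<Sum>i<m. real b ^ m * lam ^ (k + m - Suc i))"
      using b_ge m_ge k less by (intro mult_left_mono sum_mono) auto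
    finally show ?thesis using sum_power_lam[OF lam(1)] k by simp
  qed
qed

lemma N_ge_lam:
  fixes lam :: real
  assumes \<omega>: "\<And>k. \<omega> k \<in> words b m" and lam: "lam ^ m = (real b - 1) * (\<Sum>i<m. lam ^ i)" "lam \<ge> 1" "lam \<le> real b"
    and po: "\<And>k. 1 \<le> k \<Longrightarrow> k \<le> p \<Longrightarrow> progressively_overlapping m \<omega> k" and "n \<le> p"
  shows "lam ^ n \<le> real (N \<omega> n)"
  using \<open>n \<le> p\<close>
proof (induction n rule: less_induct)
  case (less n)
  show ?case
  proof (cases "n < m")
    case True
    then show ?thesis using lam by (simp add: N_small power_mono)
  next
    case False
    define k where "k = n - m"
    have k: "n = k + m" using False by (simp add: k_def)
    have "progressively_overlapping m \<omega> k"
      using po[of k] less.prems k by (cases "k = 0") (auto simp: progressively_overlapping_def)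
    then have "real (N \<omega> k) = (\<Sum>i\<le>min k (m - 1). real (H \<omega> (k - i)))"
      using N_eq_sum_H_if_progressively_overlapping[where \<omega> = \<omega> and k = k, OF \<omega>] by simp
    then have "real (N \<omega> n) = (real b - 1) * (\<Sum>i<m. real (N \<omega> (k + m - Suc i)))"
      using N_add_sum_H[of \<omega> k] k by simp
    moreover have "(real b - 1) * (\<Sum>i<m. real (N \<omega> (k + m - Suc i))) \<ge> (real b - 1) * (\<Sum>i<m. 1 * lam ^ (k + m - Suc i))"
      using b_ge m_ge k less by (intro mult_left_mono sum_mono) auto
    ultimately show ?thesis using sum_power_lam[OF lam(1), of 1 k] k by simp
  qed
qed

text \<open>By induction \<open>N n >= eta^(m-1) * N k\<close> for \<open>k = n - (m - 1)\<close>,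
  so \<open>N k <= (b - eta) * N n\<close> by the equation for eta. The loss \<open>H k\<close> in
  \<open>N_step\<close> is at most \<open>N k\<close>, which leaves
  \<open>eta * N n\<close>.\<close>

lemma N_Suc_ge_eta:
  fixes eta :: real
  assumes eta: "(real b - eta) * eta ^ (m - 1) = 1" "eta \<ge> 1" "eta \<le> real b"
  shows "eta * N \<omega> n \<le> N \<omega> (Suc n)"
proof (induction n rule: less_induct)
  case (less n)
  show ?case
  proof (cases "Suc n < m")
    case True
    then show ?thesis using eta by (simp add: N_small mult_right_mono)
  next
    case False
    define k where "k = Suc n - m"
    have k: "Suc n = k + m" "n = k + (m - 1)" using False m_ge by (auto simp: k_def)
    have "eta ^ j * N \<omega> k \<le> N \<omega> (k + j)" if "j \<le> m - 1" for j
      using that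
    proof (induction j)
      case (Suc j)
      then have "eta * (eta ^ j * N \<omega> k) \<le> eta * N \<omega> (k + j)"
        using eta by (intro mult_left_mono) auto
      also have "\<dots> \<le> N \<omega> (k + Suc j)" using less[of "k + j"] Suc.prems k by simp
      finally show ?case by (simp add: mult.assoc)
    qed simp
    from this[of "m - 1"] have "eta ^ (m - 1) * N \<omega> k \<le> N \<omega> n" using k by simp
    then have "(real b - eta) * (eta ^ (m - 1) * N \<omega> k) \<le> (real b - eta) * N \<omega> n"
      using eta by (intro mult_left_mono) auto
    then have "real (N \<omega> k) \<le> (real b - eta) * N \<omega> n" using eta by (simp flip: mult.assoc)
    moreover have "real (b * N \<omega> n) \<le> real (N \<omega> (Suc n) + N \<omega> k)"
      using N_step[of \<omega> k] H_le_N[of \<omega> k] k by (simp only: of_nat_le_iff) (metis add.commute add_diff_cancel_right' add_le_mono1 k_def plus_1_eq_Suc)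
    ultimately show ?thesis by (simp add: algebra_simps)
  qed
qed

lemma N_ge_eta:
  fixes eta :: real
  assumes "(real b - eta) * eta ^ (m - 1) = 1" "eta \<ge> 1" "eta \<le> real b"
  shows "eta ^ n \<le> N \<omega> n"
proof (induction n)
  case (Suc n)
  then have "eta * eta ^ n \<le> eta * N \<omega> n" using assms by (intro mult_left_mono) auto
  then show ?case using N_Suc_ge_eta[OF assms, of \<omega> n] by simp
qed simp

text \<open>The argument of \<open>N_Suc_ge_eta\<close> reversed, now with \<open>H k = N k\<close>.
  The initial values grow by the factor \<open>b > eta\<close>, which costs an additive error; the
  error \<open>b ^ m\<close> reproduces itself along the recursion.\<close>

lemma N_Suc_le_eta:
  fixes eta :: real
  assumes eta: "(real b - eta) * eta ^ (m - 1) = 1" "eta \<ge> 2" "eta \<le> real b"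
    and \<omega>: "\<And>k. \<omega> k \<in> words b m" and td: "\<And>k. 1 \<le> k \<Longrightarrow> k \<le> q \<Longrightarrow> totally_distinct m \<omega> k"
    and "Suc n \<le> q"
  shows "real (N \<omega> (Suc n)) \<le> eta * N \<omega> n + real b ^ m"
  using \<open>Suc n \<le> q\<close>
proof (induction n rule: less_induct)
  case (less n)
  show ?case
  proof (cases "Suc n < m")
    case True
    have "real b ^ Suc n \<le> real b ^ m" using True b_ge by (intro power_increasing) auto
    then show ?thesis using True eta by (simp add: N_small add_increasing)
  next
    case False
    define k where "k = Suc n - m"
    have k: "Suc n = k + m" "n = k + (m - 1)" using False m_ge by (auto simp: k_def)
    let ?C = "real b ^ m"
    \<comment> \<open>With this bound the accumulated errors amount to at most
      \<open>b ^ m * eta^(m-1)\<close>, and the factor \<open>b - eta\<close> reduces them to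
      \<open>b ^ m\<close> again. It uses \<open>eta >= 2\<close>.\<close>
    have pow: "(\<Sum>i<j. eta ^ i) \<le> eta ^ j" for j
    proof (induction j)
      case (Suc j)
      have "2 * eta ^ j \<le> eta * eta ^ j" using eta by (intro mult_right_mono) auto
      then show ?case using Suc by simp
    qed simp
    have "N \<omega> (k + j) \<le> eta ^ j * N \<omega> k + ?C * (\<Sum>i<j. eta ^ i)" if "j \<le> m - 1" for j
      using that
    proof (induction j)
      case (Suc j)
      have "real (N \<omega> (k + Suc j)) \<le> eta * N \<omega> (k + j) + ?C"
        using less.IH[of "k + j"] less.prems Suc.prems k by simp
      also have "\<dots> \<le> eta * (eta ^ j * N \<omega> k + ?C * (\<Sum>i<j. eta ^ i)) + ?C"
        using Suc eta by (intro add_right_mono mult_left_mono) auto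
      also have "\<dots> = eta ^ Suc j * N \<omega> k + ?C * (\<Sum>i<Suc j. eta ^ i)"
        unfolding sum.lessThan_Suc_shift by (simp add: algebra_simps sum_distrib_left)
      finally show ?case .
    qed simp
    from this[of "m - 1"] have "N \<omega> n \<le> eta ^ (m - 1) * N \<omega> k + ?C * (\<Sum>i<m - 1. eta ^ i)"
      using k by simp
    also have "\<dots> \<le> eta ^ (m - 1) * N \<omega> k + ?C * eta ^ (m - 1)"
      using pow by (intro add_left_mono mult_left_mono) auto
    finally have "(real b - eta) * N \<omega> n \<le> (real b - eta) * (eta ^ (m - 1) * N \<omega> k + ?C * eta ^ (m - 1))"
      using eta by (intro mult_left_mono) auto
    also have "\<dots> = (real b - eta) * eta ^ (m - 1) * (N \<omega> k + ?C)" by (simp add: algebra_simps)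
    finally have 1: "(real b - eta) * N \<omega> n \<le> N \<omega> k + ?C" using eta by simp
    have "totally_distinct m \<omega> k"
      using td[of k] less.prems k by (cases "k = 0") (auto simp: totally_distinct_def)
    then have "H \<omega> k = N \<omega> k" using H_eq_N_if_totally_distinct \<omega> by simp
    then have "N \<omega> k + N \<omega> (Suc n) = b * N \<omega> n" using N_step[of \<omega> k] k by simp
    then have "real (N \<omega> k + N \<omega> (Suc n)) = real (b * N \<omega> n)" by (rule arg_cong)
    then show ?thesis using 1 by (simp add: algebra_simps)
  qed
qed

lemma N_le_eta:
  fixes eta :: real
  assumes eta: "(real b - eta) * eta ^ (m - 1) = 1" "eta \<ge> 2" "eta \<le> real b"
    and \<omega>: "\<And>k. \<omega> k \<in> words b m" and td: "\<And>k. 1 \<le> k \<Longrightarrow> k \<le> q \<Longrightarrow> totally_distinct m \<omega> k"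
    and "n \<le> q"
  shows "real (N \<omega> n) \<le> (1 + real b ^ m) * eta ^ n"
proof -
  \<comment> \<open>Subtracting \<open>b ^ m\<close> absorbs the additive error of each step, again
    because \<open>eta >= 2\<close>.\<close>
  have "real (N \<omega> n) \<le> (1 + real b ^ m) * eta ^ n - real b ^ m"
    using \<open>n \<le> q\<close>
  proof (induction n)
    case (Suc n)
    have "real (N \<omega> (Suc n)) \<le> eta * N \<omega> n + real b ^ m"
      using N_Suc_le_eta[OF eta \<omega> td Suc.prems] .
    also have "\<dots> \<le> eta * ((1 + real b ^ m) * eta ^ n - real b ^ m) + real b ^ m"
      using Suc eta by (intro add_right_mono mult_left_mono) auto
    also have "\<dots> = (1 + real b ^ m) * eta ^ Suc n - (eta - 1) * real b ^ m"
      by (simp add: algebra_simps)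
    also have "\<dots> \<le> (1 + real b ^ m) * eta ^ Suc n - 1 * real b ^ m"
      using eta by (intro diff_left_mono mult_right_mono) auto
    finally show ?case by simp
  qed simp
  then show ?thesis by (simp add: add_increasing2 order_trans)
qed

end

section \<open>Ahlfors regularity from exponential growth\<close>

text \<open>The premeasure is defined by sequences of sets; a finite cover is padded with empty
  sets, which cost 0 by the convention in \<open>diam_pow\<close>.\<close>

lemma hausdorff_premeasure_le_finite_cover:
  fixes U :: "'i \<Rightarrow> 'a::metric_space set"
  assumes T: "finite T" and cover: "A \<subseteq> (\<Union>t\<in>T. U t)"
    and small: "\<And>t. t \<in> T \<Longrightarrow> bounded (U t) \<and> diameter (U t) \<le> \<delta>" and "0 \<le> \<delta>"
  shows "hausdorff_premeasure s \<delta> A \<le> (\<Sum>t\<in>T. ennreal (diam_pow s (U t)))"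
proof -
  obtain h where h: "bij_betw h {0..<card T} T"
    using ex_bij_betw_nat_finite[OF T] by blast
  define V where "V = (\<lambda>i. if i < card T then U (h i) else {})"
  have hT: "h i \<in> T" if "i < card T" for i using h that by (auto simp: bij_betw_def)
  have "A \<subseteq> (\<Union>i. V i)"
  proof
    fix a assume "a \<in> A"
    then obtain t where t: "t \<in> T" "a \<in> U t" using cover by auto
    then obtain i where "i < card T" "t = h i"
      using h by (metis bij_betw_imp_surj_on imageE atLeastLessThan_iff)
    then show "a \<in> (\<Union>i. V i)" using t by (auto simp: V_def)
  qed
  moreover have "bounded (V i) \<and> diameter (V i) \<le> \<delta>" for i
    using small hT \<open>0 \<le> \<delta>\<close> by (simp add: V_def)
  ultimately have "hausdorff_premeasure s \<delta> A \<le> (\<Sum>i. ennreal (diam_pow s (V i)))"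
    unfolding hausdorff_premeasure_def by (intro INF_lower) simp
  also have "\<dots> = (\<Sum>i\<in>{0..<card T}. ennreal (diam_pow s (V i)))"
    by (rule suminf_finite) (auto simp: V_def diam_pow_def)
  also have "\<dots> = (\<Sum>i\<in>{0..<card T}. ennreal (diam_pow s (U (h i))))"
    by (rule sum.cong) (auto simp: V_def)
  also have "\<dots> = (\<Sum>t\<in>T. ennreal (diam_pow s (U t)))"
    by (rule sum.reindex_bij_betw[OF h])
  finally show ?thesis .
qed

definition code :: "nat \<Rightarrow> nat list \<Rightarrow> nat" where
  "code b w = foldl (\<lambda>a d. a * b + d) 0 w"

lemma code_Nil [simp]: "code b [] = 0"
  and code_snoc [simp]: "code b (w @ [d]) = code b w * b + d"
  by (simp_all add: code_def)

lemma code_append: "code b (u @ v) = code b u * b ^ length v + code b v"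
proof (induction v rule: rev_induct)
  case (snoc d v)
  have "code b (u @ v @ [d]) = code b (u @ v) * b + d"
    using code_snoc[of b "u @ v" d] by simp
  then show ?case using snoc by (simp add: algebra_simps)
qed simp

lemma code_less: "w \<in> words b n \<Longrightarrow> code b w < b ^ n"
proof (induction n arbitrary: w)
  case (Suc n)
  then obtain u d where w: "w = u @ [d]" "u \<in> words b n" "d < b"
    by (cases w rule: rev_cases) (auto simp: words_def)
  then have "(code b u + 1) * b \<le> b ^ n * b" using Suc.IH by (intro mult_right_mono) (auto simp: Suc_le_eq)
  then show ?case using w by (simp add: algebra_simps)
qed (simp add: words_def)

lemma code_inj: "u \<in> words b n \<Longrightarrow> v \<in> words b n \<Longrightarrow> code b u = code b v \<Longrightarrow> u = v"
proof (induction n arbitrary: u v)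
  case (Suc n)
  obtain u' d where u: "u = u' @ [d]" "u' \<in> words b n" "d < b"
    using Suc.prems(1) by (cases u rule: rev_cases) (auto simp: words_def)
  obtain v' d' where v: "v = v' @ [d']" "v' \<in> words b n" "d' < b"
    using Suc.prems(2) by (cases v rule: rev_cases) (auto simp: words_def)
  have eq: "code b u' * b + d = code b v' * b + d'" using Suc.prems(3) u v by simp
  have "(code b u' * b + d) mod b = d" "(code b v' * b + d') mod b = d'" using u v by simp_all
  moreover have "(code b u' * b + d) div b = code b u'" "(code b v' * b + d') div b = code b v'"
    using u v by simp_all
  ultimately show ?case using eq Suc.IH[of u' v'] u v by metis
qed (simp add: words_def)

definition expansion :: "nat \<Rightarrow> (nat \<Rightarrow> nat) \<Rightarrow> real" where
  "expansion b e = (\<Sum>i. real (e i) / real b ^ Suc i)"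

text \<open>The interval of all numbers whose expansion starts with \<open>w\<close>. It is closed
  because a tail of digits \<open>b - 1\<close> attains the right end.\<close>

definition cyl :: "nat \<Rightarrow> nat list \<Rightarrow> real set" where
  "cyl b w = {real (code b w) / real b ^ length w..(real (code b w) + 1) / real b ^ length w}"

lemma sums_max_digits:
  assumes "b \<ge> 2"
  shows "(\<lambda>i. (real b - 1) / real b ^ Suc i) sums 1"
proof -
  have "(\<lambda>i. (1 / real b) ^ i) sums (1 / (1 - 1 / real b))"
    by (rule geometric_sums) (use assms in simp)
  from sums_mult[OF this, of "(real b - 1) / real b"] show ?thesis
    using assms by (simp add: field_simps power_divide)
qed

lemma digit_le: "d < b \<Longrightarrow> real d / real b ^ Suc i \<le> (real b - 1) / real b ^ Suc i"
  by (intro divide_right_mono) auto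

lemma summable_expansion:
  assumes "b \<ge> 2" "\<And>i. e i < b"
  shows "summable (\<lambda>i. real (e i) / real b ^ Suc i)"
  using digit_le[OF assms(2)]
  by (intro summable_comparison_test'[OF sums_summable[OF sums_max_digits[OF assms(1)]], of 0]) auto

lemma expansion_bounds:
  assumes "b \<ge> 2" "\<And>i. e i < b"
  shows "0 \<le> expansion b e" "expansion b e \<le> 1"
proof -
  show "0 \<le> expansion b e"
    unfolding expansion_def by (rule suminf_nonneg[OF summable_expansion[OF assms]]) simp
  have "expansion b e \<le> (\<Sum>i. (real b - 1) / real b ^ Suc i)"
    unfolding expansion_def
    by (intro suminf_le digit_le assms(2) summable_expansion[OF assms] sums_summable[OF sums_max_digits[OF assms(1)]])
  then show "expansion b e \<le> 1" using sums_unique[OF sums_max_digits[OF assms(1)]] by simp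
qed

lemma expansion_in_cyl:
  assumes b: "b \<ge> 2" "\<And>i. e i < b"
  shows "expansion b e \<in> cyl b (map e [0..<n])"
proof -
  let ?t = "expansion b (\<lambda>i. e (i + n))"
  have sum: "(\<Sum>i<n. real (e i) / real b ^ Suc i) = real (code b (map e [0..<n])) / real b ^ n"
    by (induction n) (use b in \<open>auto simp: field_simps\<close>)
  have "(\<Sum>i. real (e (i + n)) / real b ^ Suc (i + n)) = (\<Sum>i. real (e (i + n)) / real b ^ Suc i / real b ^ n)"
    by (simp add: power_add mult.assoc)
  also have "\<dots> = ?t / real b ^ n"
    unfolding expansion_def by (rule suminf_divide, rule summable_expansion) (use b in auto)
  finally have "expansion b e = ?t / real b ^ n + real (code b (map e [0..<n])) / real b ^ n"
    using suminf_split_initial_segment[OF summable_expansion[of b e, OF b], of n] sum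
    by (simp add: expansion_def)
  moreover have "0 \<le> ?t" "?t \<le> 1" using expansion_bounds[of b "\<lambda>i. e (i + n)"] b by auto
  ultimately show ?thesis
    using b by (simp add: cyl_def add_divide_distrib divide_right_mono)
qed

lemma cyl_append_subset:
  assumes "b \<ge> 2" "v \<in> words b t"
  shows "cyl b (u @ v) \<subseteq> cyl b u"
proof -
  have t: "length v = t" using assms by (simp add: words_def)
  have "code b v + 1 \<le> b ^ t" using code_less[OF assms(2)] by simp
  then have "real (code b v + 1) \<le> real (b ^ t)" by (simp only: of_nat_le_iff)
  then have le: "real (code b v) + 1 \<le> real b ^ t" by simp
  have pos: "real b ^ length u > 0" "real b ^ t > 0" using assms(1) by simp_all
  have "real (code b u) / real b ^ length u \<le> real (code b (u @ v)) / real b ^ length (u @ v)"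
    using pos t by (simp add: code_append power_add field_simps)
  moreover have "(real (code b (u @ v)) + 1) / real b ^ length (u @ v) \<le>
      (real (code b u) * real b ^ t + real b ^ t) / real b ^ length (u @ v)"
    using pos t le by (intro divide_right_mono) (simp_all add: code_append)
  moreover have "\<dots> = (real (code b u) + 1) / real b ^ length u"
    using pos t by (simp add: power_add field_simps)
  ultimately show ?thesis unfolding cyl_def by auto
qed

lemma diameter_cyl: "diameter (cyl b w) = 1 / real b ^ length w"
  and bounded_cyl: "bounded (cyl b w)"
proof -
  have "real (code b w) / real b ^ length w \<le> (real (code b w) + 1) / real b ^ length w"
    by (intro divide_right_mono) auto
  then show "diameter (cyl b w) = 1 / real b ^ length w"
    unfolding cyl_def by (simp add: diameter_closed_interval diff_divide_distrib[symmetric])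
qed (simp add: cyl_def)

lemma continuous_on_expansion:
  assumes "b \<ge> 2"
  shows "continuous_on {e. \<forall>i. e i < b} (expansion b)"
proof (rule uniform_limit_theorem)
  show "uniform_limit {e. \<forall>i. e i < b} (\<lambda>n e. \<Sum>i<n. real (e i) / real b ^ Suc i) (expansion b) sequentially"
    unfolding expansion_def
    by (rule Weierstrass_m_test[OF _ sums_summable[OF sums_max_digits[OF assms]]])
      (use digit_le in auto)
  show "\<forall>\<^sub>F n in sequentially. continuous_on {e. \<forall>i. e i < b} (\<lambda>e. \<Sum>i<n. real (e i) / real b ^ Suc i)"
  proof (intro always_eventually allI continuous_on_sum continuous_on_divide continuous_on_const)
    fix i
    show "continuous_on {e. \<forall>i. e i < b} (\<lambda>e. real (e i))"
      by (rule continuous_on_of_nat, rule continuous_on_subset[OF continuous_on_product_coordinates]) simp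
  qed (use assms in auto)
qed simp

lemma exists_inverse_power_le:
  assumes "b \<ge> 2" "0 < r"
  shows "\<exists>n. 1 / real b ^ n \<le> r"
proof -
  obtain n where "(1 / real b) ^ n < r" using real_arch_pow_inv[of r "1 / real b"] assms by auto
  then show ?thesis by (intro exI[of _ n]) (simp add: power_divide)
qed

context forbidden_words
begin

section \<open>K as the image of a compact space of digit sequences\<close>

definition adm_seq :: "(nat \<Rightarrow> nat list) \<Rightarrow> (nat \<Rightarrow> nat) set" where
  "adm_seq \<omega> = {e. (\<forall>i. e i < b) \<and> (\<forall>k. map e [k..<k + m] \<noteq> \<omega> k)}"

lemma K_set_eq: "K_set b m \<omega> = expansion b ` adm_seq \<omega>"
proof
  have shift: "map d [k + 1..<k + m + 1] = map (\<lambda>i. d (Suc i)) [k..<k + m]" for d :: "nat \<Rightarrow> nat" and k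
    by (rule nth_equalityI) (auto simp del: upt_Suc)
  show "K_set b m \<omega> \<subseteq> expansion b ` adm_seq \<omega>"
  proof
    fix x assume "x \<in> K_set b m \<omega>"
    then obtain d where d: "x = (\<Sum>i. real (d (Suc i)) / real b ^ Suc i)"
      "\<forall>i\<ge>1. d i < b" "\<forall>k. map d [k + 1..<k + m + 1] \<noteq> \<omega> k"
      by (auto simp: K_set_def)
    then have "(\<lambda>i. d (Suc i)) \<in> adm_seq \<omega>" unfolding shift adm_seq_def by simp
    then show "x \<in> expansion b ` adm_seq \<omega>"
      by (rule image_eqI[rotated]) (simp add: d(1) expansion_def)
  qed
  show "expansion b ` adm_seq \<omega> \<subseteq> K_set b m \<omega>"
  proof (rule image_subsetI)
    fix e assume e: "e \<in> adm_seq \<omega>"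
    then have "\<forall>i\<ge>1. e (i - 1) < b" "\<forall>k. map (\<lambda>i. e (i - 1)) [k + 1..<k + m + 1] \<noteq> \<omega> k"
      unfolding shift by (simp_all add: adm_seq_def)
    moreover have "expansion b e = (\<Sum>i. real (e (Suc i - 1)) / real b ^ Suc i)"
      by (simp add: expansion_def)
    ultimately show "expansion b e \<in> K_set b m \<omega>"
      unfolding K_set_def mem_Collect_eq by (intro exI[of _ "\<lambda>i. e (i - 1)"] conjI)
  qed
qed

text \<open>Each forbidden block constrains finitely many coordinates, so the admissible sequences
  form a closed subset of a product of finite sets, and \<open>expansion\<close> is continuous
  there.\<close>

lemma compact_K_set: "compact (K_set b m \<omega>)"
  unfolding K_set_eq
proof (rule compact_continuous_image)
  show "continuous_on (adm_seq \<omega>) (expansion b)"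
    by (rule continuous_on_subset[OF continuous_on_expansion]) (use b_ge in \<open>auto simp: adm_seq_def\<close>)
  have "compactin (product_topology (\<lambda>_. euclidean) UNIV) (PiE UNIV (\<lambda>_::nat. {0..<b}))"
    by (simp add: compactin_PiE finite_imp_compact)
  then have "compact (PiE UNIV (\<lambda>_::nat. {0..<b}))"
    by (simp add: euclidean_product_topology)
  moreover have "closed {e. map e [k..<k + m] \<noteq> \<omega> k}" for k
  proof (cases "length (\<omega> k) = m")
    case True
    have "{e. map e [k..<k + m] \<noteq> \<omega> k} = (\<Union>i<m. (\<lambda>e. e (k + i)) -` (- {\<omega> k ! i}))"
      using True by (auto simp: list_eq_iff_nth_eq)
    also have "closed \<dots>"
      by (intro closed_UN finite_lessThan ballI closed_vimage continuous_on_product_coordinates)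
        (simp add: closed_def open_discrete)
    finally show ?thesis .
  next
    case False
    then have "{e. map e [k..<k + m] \<noteq> \<omega> k} = UNIV" by (auto dest: arg_cong[of _ _ length])
    then show ?thesis by simp
  qed
  then have "closed (\<Inter>k. {e. map e [k..<k + m] \<noteq> \<omega> k})" by (intro closed_INT) simp
  moreover have "adm_seq \<omega> = PiE UNIV (\<lambda>_::nat. {0..<b}) \<inter> (\<Inter>k. {e. map e [k..<k + m] \<noteq> \<omega> k})"
    by (auto simp: adm_seq_def PiE_def)
  ultimately show "compact (adm_seq \<omega>)" by (simp add: compact_Int_closed)
qed

lemma adm_seq_prefix:
  assumes "e \<in> adm_seq \<omega>"
  shows "map e [0..<n] \<in> adm \<omega> n"
proof -
  have "take m (drop k (map e [0..<n])) = map e [k..<k + m]" if "k + m \<le> n" for k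
    using that by (simp add: drop_map take_map)
  then show ?thesis using assms by (auto simp: adm_seq_def adm_def words_def)
qed

lemma adm_extends:
  assumes w: "w \<in> adm \<omega> n"
  shows "\<exists>e\<in>adm_seq \<omega>. map e [0..<n] = w"
proof -
  \<comment> \<open>Every new letter differs from the last letter of the forbidden word ending at
    its place, the one starting at \<open>i + 1 - m\<close>, so no window that ends beyond
    \<open>w\<close> can be forbidden.\<close>
  define e where "e = (\<lambda>i. if i < n then w ! i else if last (\<omega> (i + 1 - m)) = 0 then 1 else 0)"
  have lw: "length w = n" using length_adm[OF w] .
  have we: "map e [0..<n] = w" using lw by (auto simp: e_def list_eq_iff_nth_eq)
  have "e i < b" for i
  proof (cases "i < n")
    case True
    have "set w \<subseteq> {0..<b}" using w by (simp add: adm_def words_def)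
    then have "w ! i \<in> {0..<b}" using True lw nth_mem by blast
    then show ?thesis using True by (simp add: e_def)
  qed (use b_ge in \<open>auto simp: e_def\<close>)
  moreover have "map e [k..<k + m] \<noteq> \<omega> k" for k
  proof (cases "k + m \<le> n")
    case True
    then have "map e [k..<k + m] = take m (drop k (map e [0..<n]))"
      by (simp add: drop_map take_map)
    then show ?thesis using w we True by (simp add: adm_def)
  next
    case False
    define j where "j = k + m - 1"
    have j: "k + m = Suc j" "k \<le> j" "\<not> j < n" "j + 1 - m = k" using False m_ge by (auto simp: j_def)
    have "last (map e [k..<k + m]) = e j" using j by simp
    also have "\<dots> \<noteq> last (\<omega> k)" using j by (simp add: e_def)
    finally show ?thesis by metis
  qed
  ultimately show ?thesis using we by (auto simp: adm_seq_def)
qed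

text \<open>Relative to \<open>N \<omega> n\<close>, the size of this set stands in for the mass of
  the ball.\<close>

definition near :: "(nat \<Rightarrow> nat list) \<Rightarrow> nat \<Rightarrow> real \<Rightarrow> real \<Rightarrow> nat list set" where
  "near \<omega> n x r = {w \<in> adm \<omega> n. cyl b w \<inter> cball x r \<noteq> {}}"

lemma finite_near [simp]: "finite (near \<omega> n x r)"
  by (simp add: near_def)

text \<open>The cylinders of level \<open>l\<close> correspond to integers \<open>code b w\<close>,
  and those meeting the ball lie in an interval of length 3.\<close>

lemma card_near_le_4:
  assumes r: "r \<le> 1 / real b ^ l"
  shows "card (near \<omega> l x r) \<le> 4"
proof -
  define X where "X = x * real b ^ l"
  have "card (near \<omega> l x r) \<le> card {\<lceil>X - 2\<rceil>..\<lfloor>X + 1\<rfloor>}"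
  proof (rule card_inj_on_le[of "\<lambda>w. int (code b w)"])
    show "inj_on (\<lambda>w. int (code b w)) (near \<omega> l x r)"
      using code_inj[of _ b l] by (auto simp: inj_on_def near_def adm_def)
    show "(\<lambda>w. int (code b w)) ` near \<omega> l x r \<subseteq> {\<lceil>X - 2\<rceil>..\<lfloor>X + 1\<rfloor>}"
    proof (rule image_subsetI)
      fix w assume w: "w \<in> near \<omega> l x r"
      then obtain y where y: "y \<in> cyl b w" "y \<in> cball x r" by (auto simp: near_def)
      have l: "length w = l" using w by (auto simp: near_def intro: length_adm)
      have bl: "real b ^ l > 0" using b_ge by simp
      have c: "real (code b w) \<le> y * real b ^ l" "y * real b ^ l \<le> real (code b w) + 1"
        using y bl l by (auto simp: cyl_def field_simps)
      have "x - y \<le> 1 / real b ^ l" "y - x \<le> 1 / real b ^ l" using y r by (auto simp: dist_real_def)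
      then have "(x - y) * real b ^ l \<le> 1" "(y - x) * real b ^ l \<le> 1"
        using bl by (auto simp: field_simps)
      then have "X - 2 \<le> real_of_int (int (code b w))" "real_of_int (int (code b w)) \<le> X + 1"
        using c by (simp_all add: X_def algebra_simps)
      then show "int (code b w) \<in> {\<lceil>X - 2\<rceil>..\<lfloor>X + 1\<rfloor>}"
        unfolding atLeastAtMost_iff ceiling_le_iff le_floor_iff by blast
    qed
  qed simp
  also have "\<dots> \<le> 4"
  proof -
    have "\<lfloor>X + 1\<rfloor> - \<lceil>X - 2\<rceil> + 1 \<le> 4" by linarith
    then show ?thesis unfolding card_atLeastAtMost_int nat_le_iff of_nat_numeral .
  qed
  finally show ?thesis .
qed

lemma near_split:
  assumes "l \<le> n"
  shows "card (near \<omega> n x r) \<le> card (near \<omega> l x r) * N (shifted l \<omega>) (n - l)"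
proof -
  have "card (near \<omega> n x r) \<le> card (near \<omega> l x r \<times> adm (shifted l \<omega>) (n - l))"
  proof (rule card_inj_on_le[of "\<lambda>w. (take l w, drop l w)"])
    show "inj_on (\<lambda>w. (take l w, drop l w)) (near \<omega> n x r)"
      by (rule inj_onI) (metis append_take_drop_id prod.inject)
    show "(\<lambda>w. (take l w, drop l w)) ` near \<omega> n x r \<subseteq> near \<omega> l x r \<times> adm (shifted l \<omega>) (n - l)"
    proof (rule image_subsetI)
      fix w assume w: "w \<in> near \<omega> n x r"
      have "drop l w \<in> words b (n - l)" "drop l w \<in> adm (shifted l \<omega>) (n - l)" "take l w \<in> adm \<omega> l"
        using w drop_adm[of w \<omega> n l] take_adm[of w \<omega> n l] assms by (auto simp: near_def adm_def)
      moreover have "cyl b w \<subseteq> cyl b (take l w)"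
        using cyl_append_subset[of b "drop l w" "n - l" "take l w"] calculation(1) b_ge by simp
      ultimately show "(take l w, drop l w) \<in> near \<omega> l x r \<times> adm (shifted l \<omega>) (n - l)"
        using w by (auto simp: near_def)
    qed
  qed simp
  then show ?thesis by (simp add: card_cartesian_product)
qed

section \<open>Ahlfors regularity from two-sided growth bounds\<close>

context
  fixes \<omega> :: "nat \<Rightarrow> nat list" and s C :: real
  assumes s: "s > 0" and C: "C \<ge> 1"
    and growth_lower: "\<And>n. (real b powr s) ^ n \<le> C * real (N \<omega> n)"
    and growth_upper: "\<And>n. real (N \<omega> n) \<le> C * (real b powr s) ^ n"
begin

definition "B = real b powr s"
text \<open>4 counts the cylinders of comparable size meeting a ball, \<open>2 ^ (m - 1)\<close>
  comes from \<open>N_supermult\<close>, \<open>C ^ 2\<close> from using both growth bounds, and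
  \<open>B\<close> from rounding the radius to a power of \<open>b\<close>.\<close>

definition "C1 = 4 * 2 ^ (m - 1) * C ^ 2 * B"

lemma B_gt_1: "B > 1"
  using s b_ge by (simp add: B_def)

lemma C1_ge: "C1 \<ge> 1" "C1 \<ge> C"
proof -
  have "(1::real) \<le> 4 * 2 ^ (m - 1)"
    using one_le_power[of "2::real" "m - 1"] by linarith
  then have "1 * C * 1 \<le> (4 * 2 ^ (m - 1)) * C ^ 2 * B"
    using C B_gt_1 by (intro mult_mono) (auto simp: power2_eq_square)
  then show "C1 \<ge> C" by (simp add: C1_def)
  then show "C1 \<ge> 1" using C by simp
qed

lemma inverse_power_powr: "(1 / real b ^ n) powr s = 1 / B ^ n"
proof -
  have "(1 / real b ^ n) powr s = 1 / (real b ^ n) powr s" using b_ge by (simp add: powr_divide)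
  also have "(real b ^ n) powr s = B ^ n"
    using b_ge by (simp add: B_def powr_realpow[symmetric] powr_powr mult.commute)
  finally show ?thesis .
qed

lemma card_near_le:
  assumes n: "1 / real b ^ n \<le> r"
  shows "real (card (near \<omega> n x r)) \<le> C1 * B ^ n * r powr s"
proof (cases "r < 1")
  case False
  have "real (card (near \<omega> n x r)) \<le> real (N \<omega> n)"
    unfolding of_nat_le_iff by (rule card_mono) (auto simp: near_def)
  also have "\<dots> \<le> C * B ^ n * 1" using growth_upper[of n] by (simp add: B_def)
  also have "\<dots> \<le> C1 * B ^ n * r powr s"
    using C1_ge B_gt_1 False s C by (intro mult_mono ge_one_powr_ge_zero) auto
  finally show ?thesis .
next
  case True
  have bpos: "real b > 1" using b_ge by simp
  have r0: "0 < r" by (rule less_le_trans[OF _ n]) (use b_ge in simp)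
  \<comment> \<open>With \<open>j = Suc l\<close> this gives b^(-l-1) < r <= b^(-l). So at most 4
    cylinders of level \<open>l\<close> meet the ball, and each word of level \<open>n\<close> near
    it continues one of them.\<close>
  define j where "j = (LEAST j. 1 / real b ^ j < r)"
  have ex: "\<exists>j. 1 / real b ^ j < r"
  proof -
    obtain j where "1 / real b ^ j \<le> r / 2" using exists_inverse_power_le[of b "r / 2"] b_ge r0 by auto
    then show ?thesis using r0 by (intro exI[of _ j]) linarith
  qed
  have j: "1 / real b ^ j < r" unfolding j_def by (rule LeastI_ex[OF ex])
  have nj: "r \<le> 1 / real b ^ i" if "i < j" for i
    using not_less_Least[of i "\<lambda>j. 1 / real b ^ j < r"] that by (simp add: j_def)
  have "j \<noteq> 0" using j True by (intro notI) simp
  then obtain l where l: "j = Suc l" by (cases j) auto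
  have ln: "l \<le> n"
  proof (rule ccontr)
    assume "\<not> l \<le> n"
    then have "r \<le> 1 / real b ^ Suc n" using nj[of "Suc n"] l by simp
    also have "\<dots> < 1 / real b ^ n" using bpos by (simp add: field_simps)
    finally show False using n by simp
  qed
  have "real (N \<omega> l * N (shifted l \<omega>) (n - l)) \<le> real (2 ^ (m - 1) * N \<omega> (l + (n - l)))"
    unfolding of_nat_le_iff by (rule N_supermult)
  then have "real (N \<omega> l) * real (N (shifted l \<omega>) (n - l)) \<le> 2 ^ (m - 1) * real (N \<omega> n)"
    using ln by simp
  also have "\<dots> \<le> 2 ^ (m - 1) * (C * B ^ n)"
    using growth_upper[of n] by (intro mult_left_mono) (auto simp: B_def)
  finally have 1: "C * (real (N \<omega> l) * real (N (shifted l \<omega>) (n - l))) \<le> C * (2 ^ (m - 1) * (C * B ^ n))"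
    using C by (intro mult_left_mono) auto
  have "B ^ l * real (N (shifted l \<omega>) (n - l)) \<le> C * real (N \<omega> l) * real (N (shifted l \<omega>) (n - l))"
    using growth_lower[of l] by (intro mult_right_mono) (auto simp: B_def)
  then have 2: "B ^ l * real (N (shifted l \<omega>) (n - l)) \<le> 2 ^ (m - 1) * C ^ 2 * B ^ n"
    using 1 by (simp add: power2_eq_square algebra_simps)
  have "1 / B ^ Suc l \<le> r powr s"
    using powr_mono2[of s "1 / real b ^ Suc l" r] j l s inverse_power_powr[of "Suc l"] by simp
  then have 3: "1 \<le> B ^ l * (B * r powr s)" using B_gt_1 by (simp add: field_simps)
  have "real (N (shifted l \<omega>) (n - l)) * 1 \<le> real (N (shifted l \<omega>) (n - l)) * (B ^ l * (B * r powr s))"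
    using 3 by (intro mult_left_mono) auto
  also have "\<dots> = (B ^ l * real (N (shifted l \<omega>) (n - l))) * (B * r powr s)" by simp
  also have "\<dots> \<le> (2 ^ (m - 1) * C ^ 2 * B ^ n) * (B * r powr s)"
    using 2 B_gt_1 by (intro mult_right_mono) auto
  finally have 4: "4 * real (N (shifted l \<omega>) (n - l)) \<le> C1 * B ^ n * r powr s"
    by (simp add: C1_def algebra_simps)
  have "card (near \<omega> n x r) \<le> 4 * N (shifted l \<omega>) (n - l)"
    using near_split[OF ln, of \<omega> x r] card_near_le_4[of r l \<omega> x] nj[of l] l
    by (meson le_trans lessI mult_le_mono1)
  then have "real (card (near \<omega> n x r)) \<le> real (4 * N (shifted l \<omega>) (n - l))"
    by (simp only: of_nat_le_iff)
  then show ?thesis using 4 by simp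
qed

lemma hausdorff_measure_K_set_le:
  assumes "0 < r"
  shows "hausdorff_measure s (K_set b m \<omega> \<inter> cball x r) \<le> ennreal (C1 * r powr s)"
  unfolding hausdorff_measure_def
proof (rule SUP_least)
  fix \<delta> :: real assume "\<delta> \<in> {0<..}"
  then obtain n where "1 / real b ^ n \<le> min \<delta> r"
    using exists_inverse_power_le[of b "min \<delta> r"] b_ge assms by auto
  then have n: "1 / real b ^ n \<le> \<delta>" "1 / real b ^ n \<le> r" by auto
  have "K_set b m \<omega> \<inter> cball x r \<subseteq> (\<Union>w\<in>near \<omega> n x r. cyl b w)"
  proof
    fix y assume y: "y \<in> K_set b m \<omega> \<inter> cball x r"
    then obtain e where e: "e \<in> adm_seq \<omega>" "y = expansion b e" by (auto simp: K_set_eq)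
    then have "y \<in> cyl b (map e [0..<n])"
      using expansion_in_cyl[of b e n] b_ge by (auto simp: adm_seq_def)
    moreover have "map e [0..<n] \<in> near \<omega> n x r"
      using calculation y adm_seq_prefix[OF e(1)] by (auto simp: near_def)
    ultimately show "y \<in> (\<Union>w\<in>near \<omega> n x r. cyl b w)" by blast
  qed
  then have "hausdorff_premeasure s \<delta> (K_set b m \<omega> \<inter> cball x r) \<le> (\<Sum>w\<in>near \<omega> n x r. ennreal (diam_pow s (cyl b w)))"
    using n \<open>\<delta> \<in> {0<..}\<close>
    by (intro hausdorff_premeasure_le_finite_cover)
      (auto simp: diameter_cyl bounded_cyl near_def length_adm)
  also have "\<dots> = (\<Sum>w\<in>near \<omega> n x r. ennreal (1 / B ^ n))"
  proof (rule sum.cong)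
    fix w assume "w \<in> near \<omega> n x r"
    then have "length w = n" "cyl b w \<noteq> {}" by (auto simp: near_def length_adm)
    then show "ennreal (diam_pow s (cyl b w)) = ennreal (1 / B ^ n)"
      using s by (simp add: diam_pow_def diameter_cyl inverse_power_powr)
  qed simp
  also have "\<dots> = ennreal (real (card (near \<omega> n x r)) * (1 / B ^ n))"
    unfolding sum_constant ennreal_of_nat_eq_real_of_nat
    by (rule ennreal_mult[symmetric]) (use B_gt_1 in auto)
  also have "\<dots> \<le> ennreal (C1 * r powr s)"
    using card_near_le[OF n(2), of x] B_gt_1 by (intro ennreal_leI) (simp add: field_simps)
  finally show "hausdorff_premeasure s \<delta> (K_set b m \<omega> \<inter> cball x r) \<le> ennreal (C1 * r powr s)" .
qed

text \<open>A lower bound for the share of the words of level \<open>n\<close> that start with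
  \<open>u\<close>: up to constants it is at least the share B^(-n0) expected from the growth
  rate.\<close>

lemma card_extensions_ge:
  assumes u: "u \<in> adm \<omega> n0" and "n0 \<le> n"
  shows "B ^ n \<le> 2 ^ (m - 1) * C ^ 2 * B ^ n0 * card (extensions \<omega> u (n - n0))"
proof -
  have 1: "B ^ n \<le> C * real (N \<omega> n)" using growth_lower by (simp add: B_def)
  have "N \<omega> n \<le> N \<omega> n0 * N (shifted n0 \<omega>) (n - n0)" using N_submult[of \<omega> n0 "n - n0"] assms by simp
  also have "\<dots> \<le> N \<omega> n0 * (2 ^ (m - 1) * card (extensions \<omega> u (n - n0)))"
    by (intro mult_left_mono N_le_extensions[OF u]) simp
  finally have "real (N \<omega> n) \<le> real (N \<omega> n0 * (2 ^ (m - 1) * card (extensions \<omega> u (n - n0))))"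
    by (simp only: of_nat_le_iff)
  also have "\<dots> = real (N \<omega> n0) * (2 ^ (m - 1) * card (extensions \<omega> u (n - n0)))" by simp
  also have "\<dots> \<le> (C * B ^ n0) * (2 ^ (m - 1) * card (extensions \<omega> u (n - n0)))"
    using growth_upper[of n0] by (intro mult_right_mono) (auto simp: B_def)
  finally have "C * real (N \<omega> n) \<le> C * ((C * B ^ n0) * (2 ^ (m - 1) * card (extensions \<omega> u (n - n0))))"
    using C by (intro mult_left_mono) auto
  then show ?thesis using 1 by (simp add: power2_eq_square algebra_simps)
qed

definition "c0 = 1 / (2 ^ (m - 1) * C ^ 2 * C1 * B)"

lemma c0_pos: "c0 > 0"
  using C C1_ge B_gt_1 by (simp add: c0_def)

text \<open>Mass distribution principle without the measure: by compactness a cover may be taken finite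
  with positive radii, and then its sets share out the admissible words of a fine level.\<close>

lemma hausdorff_measure_K_set_ge:
  assumes x: "x \<in> K_set b m \<omega>" and r: "0 < r" "r < 1"
  shows "ennreal (c0 * r powr s) \<le> hausdorff_measure s (K_set b m \<omega> \<inter> cball x r)"
proof -
  let ?A = "K_set b m \<omega> \<inter> cball x r"
  obtain e where e: "e \<in> adm_seq \<omega>" "x = expansion b e" using x by (auto simp: K_set_eq)
  \<comment> \<open>At this level the cylinder containing \<open>x\<close> fits into the ball, while
    \<open>r\<close> is at most \<open>b\<close> times its length; this costs the factor
    \<open>B\<close> in \<open>c0\<close>.\<close>
  define n0 where "n0 = (LEAST n. 1 / real b ^ n \<le> r)"
  have n0: "1 / real b ^ n0 \<le> r"
    unfolding n0_def by (rule LeastI_ex) (use exists_inverse_power_le b_ge r in simp)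
  then have "n0 \<noteq> 0" using r by (intro notI) simp
  then obtain n1 where n1: "n0 = Suc n1" by (cases n0) auto
  have "r \<le> 1 / real b ^ n1"
    using not_less_Least[of n1 "\<lambda>n. 1 / real b ^ n \<le> r"] n1 by (simp add: n0_def)
  then have "r powr s \<le> 1 / B ^ n1"
    using powr_mono2[of s r "1 / real b ^ n1"] r s inverse_power_powr[of n1] by simp
  then have rs: "c0 * r powr s \<le> 1 / (2 ^ (m - 1) * C ^ 2 * C1 * B ^ n0)"
    using c0_pos C C1_ge B_gt_1 unfolding c0_def n1 by (simp add: field_simps)
  define u where "u = map e [0..<n0]"
  have u: "u \<in> adm \<omega> n0" "length u = n0" unfolding u_def using adm_seq_prefix[OF e(1)] by auto
  have "x \<in> cyl b u" unfolding u_def e(2) using expansion_in_cyl[of b e n0] e b_ge by (auto simp: adm_seq_def)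
  then have cyl_u: "cyl b u \<subseteq> cball x r"
    using n0 u by (auto simp: cyl_def dist_real_def add_divide_distrib)
  \<comment> \<open>One scale is enough, as the Hausdorff measure is the supremum over all
    scales.\<close>
  have "ennreal (c0 * r powr s) \<le> hausdorff_premeasure s 1 ?A"
    unfolding hausdorff_premeasure_def
  proof (rule INF_greatest)
    fix U :: "nat \<Rightarrow> real set"
    assume "U \<in> {U. ?A \<subseteq> (\<Union>i. U i) \<and> (\<forall>i. bounded (U i) \<and> diameter (U i) \<le> 1)}"
    then have cover: "?A \<subseteq> (\<Union>i. U i)" and bdd: "\<And>i. bounded (U i)" by auto
    show "ennreal (c0 * r powr s) \<le> (\<Sum>i. ennreal (diam_pow s (U i)))"
    proof (rule ennreal_le_epsilon)
      fix \<epsilon> :: real assume \<epsilon>: "0 < \<epsilon>"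
      \<comment> \<open>The enlargements add up to \<epsilon>. They make the radius
        \<open>D i\<close>, chosen with \<open>D i powr s = t i\<close>, positive and larger than
        the diameter of \<open>U i\<close>, so that open balls cover.\<close>
      define t where "t = (\<lambda>i. diam_pow s (U i) + \<epsilon> * (1 / 2) ^ Suc i)"
      define D where "D = (\<lambda>i. t i powr (1 / s))"
      define y where "y = (\<lambda>i. SOME z. z \<in> U i)"
      have dp: "0 \<le> diam_pow s (U i)" for i by (simp add: diam_pow_def)
      have tpos: "t i > 0" for i using \<epsilon> dp[of i] by (simp add: t_def add_nonneg_pos)
      then have Dpos: "D i > 0" for i unfolding D_def by (metis less_irrefl powr_gt_zero)
      have Dt: "D i powr s = t i" for i using tpos[of i] s by (simp add: D_def powr_powr)
      have UD: "U i \<subseteq> ball (y i) (D i)" for i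
      proof
        fix z assume z: "z \<in> U i"
        then have yi: "y i \<in> U i" unfolding y_def by (rule someI)
        have "diameter (U i) = (diam_pow s (U i)) powr (1 / s)"
          using z s diameter_ge_0[OF bdd] by (auto simp: diam_pow_def powr_powr)
        also have "\<dots> < D i" unfolding D_def t_def using dp s \<epsilon> by (intro powr_less_mono2) auto
        finally show "z \<in> ball (y i) (D i)"
          using diameter_bounded_bound[OF bdd yi z] by simp
      qed
      have "compact ?A" by (intro compact_Int_closed compact_K_set) simp
      moreover have "?A \<subseteq> (\<Union>i\<in>UNIV. ball (y i) (D i))" using cover UD by blast
      ultimately obtain I where I: "finite I" "?A \<subseteq> (\<Union>i\<in>I. ball (y i) (D i))"
        using compactE_image[of ?A UNIV "\<lambda>i. ball (y i) (D i)"] by auto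
      have "\<forall>i. \<exists>n. 1 / real b ^ n \<le> D i"
        using Dpos b_ge by (intro allI exists_inverse_power_le) auto
      then obtain f where f: "\<And>i. 1 / real b ^ f i \<le> D i" by metis
      \<comment> \<open>A level at least \<open>n0\<close> and fine enough for
        \<open>card_near_le\<close> at every radius \<open>D i\<close> with \<open>i\<close> in
        \<open>I\<close>.\<close>
      define n where "n = n0 + (\<Sum>i\<in>I. f i)"
      have n: "1 / real b ^ n \<le> D i" if "i \<in> I" for i
      proof -
        have "f i \<le> n" using member_le_sum[of i I f] that I by (simp add: n_def)
        then have "1 / real b ^ n \<le> 1 / real b ^ f i"
          using b_ge by (intro divide_left_mono power_increasing) auto
        then show ?thesis using f[of i] by simp
      qed
      \<comment> \<open>The cylinder of an admissible \<open>u @ v\<close> contains a point of K in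
        the ball around \<open>x\<close>; the cover catches that point, so \<open>u @ v\<close> is
        near one of the covering balls.\<close>
      have "(\<lambda>v. u @ v) ` extensions \<omega> u (n - n0) \<subseteq> (\<Union>i\<in>I. near \<omega> n (y i) (D i))"
      proof (rule image_subsetI)
        fix v assume "v \<in> extensions \<omega> u (n - n0)"
        then have w: "u @ v \<in> adm \<omega> n" using u by (simp add: extensions_def n_def)
        then obtain e' where e': "e' \<in> adm_seq \<omega>" "map e' [0..<n] = u @ v" using adm_extends by blast
        define z where "z = expansion b e'"
        have z: "z \<in> cyl b (u @ v)"
          unfolding z_def e'(2)[symmetric] using expansion_in_cyl[of b e' n] e' b_ge by (auto simp: adm_seq_def)
        have "v \<in> words b (n - n0)"
          using w in_words_append[of u n0 v b "n - n0"] u by (simp add: adm_def n_def)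
        then have "cyl b (u @ v) \<subseteq> cyl b u" using b_ge by (intro cyl_append_subset) auto
        then have "z \<in> cball x r" using z cyl_u by blast
        moreover have "z \<in> K_set b m \<omega>" using e' by (simp add: K_set_eq z_def)
        ultimately obtain i where i: "i \<in> I" "z \<in> ball (y i) (D i)" using I by blast
        then have "z \<in> cyl b (u @ v) \<inter> cball (y i) (D i)" using z by simp
        then have "u @ v \<in> near \<omega> n (y i) (D i)" using w unfolding near_def by blast
        then show "u @ v \<in> (\<Union>i\<in>I. near \<omega> n (y i) (D i))" using i(1) by blast
      qed
      then have "card ((\<lambda>v. u @ v) ` extensions \<omega> u (n - n0)) \<le> card (\<Union>i\<in>I. near \<omega> n (y i) (D i))"
        by (intro card_mono) (use I in auto)
      also have "\<dots> \<le> (\<Sum>i\<in>I. card (near \<omega> n (y i) (D i)))" by (rule card_UN_le[OF I(1)])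
      finally have "card (extensions \<omega> u (n - n0)) \<le> (\<Sum>i\<in>I. card (near \<omega> n (y i) (D i)))"
        by (simp add: card_image inj_on_def)
      then have "real (card (extensions \<omega> u (n - n0))) \<le> (\<Sum>i\<in>I. real (card (near \<omega> n (y i) (D i))))"
        by (simp flip: of_nat_sum)
      also have "\<dots> \<le> (\<Sum>i\<in>I. C1 * B ^ n * t i)"
        using card_near_le n Dt by (intro sum_mono) metis
      also have "\<dots> = C1 * B ^ n * (\<Sum>i\<in>I. t i)" by (simp add: sum_distrib_left)
      finally have "2 ^ (m - 1) * C ^ 2 * B ^ n0 * real (card (extensions \<omega> u (n - n0)))
          \<le> 2 ^ (m - 1) * C ^ 2 * B ^ n0 * (C1 * B ^ n * (\<Sum>i\<in>I. t i))"
        using C B_gt_1 by (intro mult_left_mono) auto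
      then have "B ^ n * 1 \<le> B ^ n * (2 ^ (m - 1) * C ^ 2 * C1 * B ^ n0 * (\<Sum>i\<in>I. t i))"
        using card_extensions_ge[OF u(1), of n] by (simp add: n_def algebra_simps)
      then have "1 \<le> 2 ^ (m - 1) * C ^ 2 * C1 * B ^ n0 * (\<Sum>i\<in>I. t i)"
        using B_gt_1 by (simp only: mult_le_cancel_left_pos zero_less_power)
      then have "1 / (2 ^ (m - 1) * C ^ 2 * C1 * B ^ n0) \<le> (\<Sum>i\<in>I. t i)"
        using C C1_ge B_gt_1 by (simp add: field_simps)
      then have "ennreal (c0 * r powr s) \<le> ennreal (\<Sum>i\<in>I. t i)" using rs by (intro ennreal_leI) simp
      also have "\<dots> = (\<Sum>i\<in>I. ennreal (t i))" using tpos by (simp add: sum_ennreal less_imp_le)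
      also have "\<dots> \<le> (\<Sum>i. ennreal (t i))" using I(1) by (intro sum_le_suminf) auto
      also have "\<dots> = (\<Sum>i. ennreal (diam_pow s (U i)) + ennreal (\<epsilon> * (1 / 2) ^ Suc i))"
        unfolding t_def using dp \<epsilon> by (intro suminf_cong ennreal_plus) auto
      also have "\<dots> = (\<Sum>i. ennreal (diam_pow s (U i))) + (\<Sum>i. ennreal (\<epsilon> * (1 / 2) ^ Suc i))"
        by (intro suminf_add[symmetric]) auto
      also have "(\<Sum>i. ennreal (\<epsilon> * (1 / 2) ^ Suc i)) = ennreal (\<epsilon> * 1)"
        using \<epsilon> by (intro suminf_ennreal_eq sums_mult power_half_series) simp
      finally show "ennreal (c0 * r powr s) \<le> (\<Sum>i. ennreal (diam_pow s (U i))) + ennreal \<epsilon>" by simp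
    qed
  qed
  also have "\<dots> \<le> hausdorff_measure s ?A"
    unfolding hausdorff_measure_def by (intro SUP_upper) simp
  finally show ?thesis .
qed

lemma ahlfors_regular_K_set: "ahlfors_regular s (K_set b m \<omega>)"
  unfolding ahlfors_regular_def
proof (intro conjI compact_K_set exI[of _ "max C1 (1 / c0)"] allI impI)
  show "1 \<le> max C1 (1 / c0)" using C1_ge by simp
  fix r x :: real assume rx: "0 < r" "r < 1" "x \<in> K_set b m \<omega>"
  have "inverse (max C1 (1 / c0)) \<le> inverse (1 / c0)"
    using c0_pos by (intro le_imp_inverse_le) auto
  then have "inverse (max C1 (1 / c0)) * r powr s \<le> c0 * r powr s"
    using c0_pos by (intro mult_right_mono) auto
  then show "ennreal (inverse (max C1 (1 / c0)) * r powr s) \<le> hausdorff_measure s (K_set b m \<omega> \<inter> cball x r)"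
    using hausdorff_measure_K_set_ge[OF rx(3,1,2)] by (meson ennreal_leI order_trans)
  have "C1 * r powr s \<le> max C1 (1 / c0) * r powr s" by (intro mult_right_mono) auto
  then show "hausdorff_measure s (K_set b m \<omega> \<inter> cball x r) \<le> ennreal (max C1 (1 / c0) * r powr s)"
    using hausdorff_measure_K_set_le[OF rx(1), of x] by (meson ennreal_leI order_trans)
qed

end

end

section \<open>The two Pisot numbers\<close>

lemma poly_map_poly_of_rat_mult:
  "poly (map_poly of_rat (p * q)) x = poly (map_poly of_rat p) x * poly (map_poly of_rat q) x"
  for x :: "'a::field_char_0"
proof (induction p)
  case (pCons a p)
  have "map_poly of_rat (smult a q + pCons 0 (p * q)) =
      smult (of_rat a :: 'a) (map_poly of_rat q) + pCons 0 (map_poly of_rat (p * q))"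
    by (intro poly_eqI) (simp add: coeff_map_poly of_rat_add of_rat_mult coeff_pCons split: nat.splits)
  then show ?case using pCons by (simp add: map_poly_pCons algebra_simps)
qed simp

lemma poly_map_poly_of_rat_add:
  "poly (map_poly of_rat (p + q)) x = poly (map_poly of_rat p) x + poly (map_poly of_rat q) x"
  for x :: "'a::field_char_0"
proof -
  have "map_poly of_rat (p + q) = map_poly of_rat p + (map_poly of_rat q :: 'a poly)"
    by (intro poly_eqI) (simp add: coeff_map_poly of_rat_add)
  then show ?thesis by simp
qed

text \<open>A nonzero rational polynomial \<open>g\<close> of least degree vanishing at
  \<open>x\<close> divides all others, by division with remainder. It divides the irreducible
  \<open>f\<close> and is no unit, so \<open>f\<close> divides \<open>g\<close>.\<close>

lemma irreducible_root_imp_dvd: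
  fixes f P :: "rat poly" and x :: "'a::field_char_0"
  assumes "irreducible f" "poly (map_poly of_rat f) x = 0" "poly (map_poly of_rat P) x = 0"
  shows "f dvd P"
proof -
  let ?ev = "\<lambda>p. poly (map_poly of_rat p) x"
  let ?Q = "\<lambda>d. \<exists>g. g \<noteq> 0 \<and> ?ev g = 0 \<and> degree g = d"
  have "f \<noteq> 0" using assms(1) by auto
  then have "?Q (degree f)" using assms(2) by blast
  then have "?Q (LEAST d. ?Q d)" by (rule LeastI)
  then obtain g where g: "g \<noteq> 0" "?ev g = 0" "degree g = (LEAST d. ?Q d)" by blast
  have min: "g dvd p" if "?ev p = 0" for p
  proof (rule ccontr)
    assume "\<not> g dvd p"
    then have nz: "p mod g \<noteq> 0" by (simp add: dvd_eq_mod_eq_0)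
    have "?ev (p div g * g + p mod g) = 0" using that by simp
    then have "?ev (p mod g) = 0"
      unfolding poly_map_poly_of_rat_add poly_map_poly_of_rat_mult using g by simp
    then have "?Q (degree (p mod g))" using nz by blast
    then have "degree g \<le> degree (p mod g)" unfolding g(3) by (rule Least_le)
    then show False using degree_mod_less[OF g(1), of p] nz by simp
  qed
  have no_unit: "\<not> is_unit g"
  proof
    assume "is_unit g"
    then obtain k where "1 = g * k" by (auto elim: dvdE)
    then have "?ev 1 = ?ev (g * k)" by (rule arg_cong)
    then show False unfolding poly_map_poly_of_rat_mult using g by simp
  qed
  obtain h where h: "f = g * h" using min[OF assms(2)] by (auto elim: dvdE)
  then have "is_unit h" using irreducibleD[OF assms(1) h] no_unit by blast
  then have "f dvd g" unfolding h by (rule mult_unit_dvd_iff[THEN iffD2]) simp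
  then show ?thesis using min[OF assms(3)] by (rule dvd_trans)
qed

text \<open>Every conjugate is a root of \<open>P\<close>, because any irreducible polynomial
  vanishing at \<open>x\<close> divides it. Locating the roots of \<open>P\<close> therefore
  suffices, without deciding whether \<open>P\<close> is irreducible.\<close>

lemma pisotI:
  fixes P :: "int poly"
  assumes "lead_coeff P = 1" "poly (map_poly of_int P) x = 0" "poly (map_poly of_int P) (complex_of_real x) = 0"
    and "x > 1" and roots: "\<And>z::complex. poly (map_poly of_int P) z = 0 \<Longrightarrow> norm z \<ge> 1 \<Longrightarrow> z = of_real x"
  shows "pisot x"
  unfolding pisot_def
proof (intro conjI allI impI)
  show "algebraic_int x" using assms algebraic_int_altdef_ipoly by blast
  fix z assume "algebraic_conjugates (complex_of_real x) z" and ne: "z \<noteq> of_real x"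
  then obtain f :: "rat poly" where f: "irreducible f" "poly (map_poly of_rat f) (complex_of_real x) = 0"
    "poly (map_poly of_rat f) z = 0" by (auto simp: algebraic_conjugates_def)
  have P: "map_poly of_rat (map_poly of_int P) = (map_poly of_int P :: complex poly)"
    by (simp add: map_poly_map_poly o_def)
  have "f dvd map_poly of_int P"
    using f assms(3) P by (intro irreducible_root_imp_dvd[of f "complex_of_real x"]) auto
  then obtain g where "map_poly of_int P = f * g" by (auto elim: dvdE)
  then have "poly (map_poly of_int P) z = 0"
    using f(3) unfolding P[symmetric] by (simp add: poly_map_poly_of_rat_mult)
  then show "norm z < 1" using roots ne by force
qed fact

lemma poly_map_poly_of_int_add:
  "poly (map_poly of_int (p + q)) x = poly (map_poly of_int p) x + poly (map_poly of_int q) x"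
  for x :: "'a::{comm_ring_1,ring_char_0}"
proof -
  have "map_poly of_int (p + q) = map_poly of_int p + (map_poly of_int q :: 'a poly)"
    by (intro poly_eqI) (simp add: coeff_map_poly)
  then show ?thesis by simp
qed

lemma poly_map_poly_of_int_monom:
  "poly (map_poly of_int (monom c n)) x = of_int c * x ^ n"
  for x :: "'a::{comm_ring_1,ring_char_0}"
  by (simp add: map_poly_monom poly_monom)

lemma poly_map_poly_of_int_sum_monom:
  "poly (map_poly of_int (\<Sum>i<n. monom c i)) x = of_int c * (\<Sum>i<n. x ^ i)"
  for x :: "'a::{comm_ring_1,ring_char_0}"
  by (induction n) (simp_all add: poly_map_poly_of_int_add poly_map_poly_of_int_monom algebra_simps)

lemma lead_coeff_eq_1I:
  assumes "coeff P n = (1::int)" "\<And>i. i > n \<Longrightarrow> coeff P i = 0"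
  shows "lead_coeff P = 1"
proof -
  have "degree P \<le> n" using assms(2) by (intro degree_le) auto
  moreover have "n \<le> degree P" using assms(1) by (intro le_degree) auto
  ultimately show ?thesis using assms(1) by simp
qed

context forbidden_words
begin

section \<open>The equation of eta\<close>

lemma eta_equation_iff:
  "z ^ m - of_nat b * z ^ (m - 1) + 1 = 0 \<longleftrightarrow> (of_nat b - z) * z ^ (m - 1) = 1"
  for z :: "'a::comm_ring_1"
proof -
  have "z ^ m = z * z ^ (m - 1)" using m_ge by (cases m) auto
  then show ?thesis by (auto simp: algebra_simps eq_neg_iff_add_eq_0)
qed

text \<open>The map $z \mapsto b - z^{1 - m}$ is a contraction on $|z| \geq 2$.\<close>

lemma eta_root_unique:
  fixes z w :: complex
  assumes z: "(of_nat b - z) * z ^ (m - 1) = 1" "norm z \<ge> 1"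
    and w: "(of_nat b - w) * w ^ (m - 1) = 1" "norm w \<ge> 1"
  shows "z = w"
proof -
  \<comment> \<open>If |z| >= 1, the equation gives |b - z| <= 1, hence |z| >= b - 1 >= 2.\<close>
  have large: "norm z \<ge> 2" if z: "(of_nat b - z) * z ^ (m - 1) = 1" "norm z \<ge> 1" for z :: complex
  proof -
    have "norm (of_nat b - z) * norm z ^ (m - 1) = 1" using z by (metis norm_mult norm_one norm_power)
    moreover have "norm (of_nat b - z) * 1 \<le> norm (of_nat b - z) * norm z ^ (m - 1)"
      using z by (intro mult_left_mono one_le_power) auto
    ultimately have "norm (of_nat b - z) \<le> 1" by simp
    moreover have "norm (of_nat b :: complex) \<le> norm (of_nat b - z) + norm z"
      using norm_triangle_ineq[of "of_nat b - z" z] by simp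
    ultimately show ?thesis using b_ge by simp
  qed
  have z2: "norm z \<ge> 2" and w2: "norm w \<ge> 2" using large z w by auto
  then have nz: "z \<noteq> 0" "w \<noteq> 0" by auto
  define u v where "u = 1 / z" and "v = 1 / w"
  have uv: "norm u \<le> 1 / 2" "norm v \<le> 1 / 2"
    using z2 w2 nz by (auto simp: u_def v_def norm_divide field_simps)
  have "of_nat b - z = u ^ (m - 1)" "of_nat b - w = v ^ (m - 1)"
    using z w nz by (auto simp: u_def v_def power_divide field_simps)
  moreover have "z - w = (of_nat b - w) - (of_nat b - z)" by simp
  ultimately have "z - w = v ^ (m - 1) - u ^ (m - 1)" by (simp only:)
  also have "\<dots> = (v - u) * (\<Sum>i<m - 1. u ^ (m - 1 - Suc i) * v ^ i)"
    by (rule power_diff_sumr2)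
  also have "v - u = (z - w) * (u * v)" using nz by (simp add: u_def v_def field_simps)
  finally have "norm (z - w) = norm ((z - w) * (u * v) * (\<Sum>i<m - 1. u ^ (m - 1 - Suc i) * v ^ i))"
    by (rule arg_cong)
  also have "\<dots> = norm (z - w) * (norm u * norm v) * norm (\<Sum>i<m - 1. u ^ (m - 1 - Suc i) * v ^ i)"
    by (simp only: norm_mult)
  \<comment> \<open>The sum is at most (m-1) / 2^(m-2) <= 1, so the distance is at most a quarter of
    itself.\<close>
  also have "\<dots> \<le> norm (z - w) * (1 / 2 * (1 / 2)) * 1"
  proof (intro mult_mono)
    have "norm (u ^ (m - 1 - Suc i) * v ^ i) \<le> (1 / 2) ^ (m - 2)" if "i \<in> {..<m - 1}" for i
    proof -
      have "norm (u ^ (m - 1 - Suc i) * v ^ i) \<le> (1 / 2) ^ (m - 1 - Suc i) * (1 / 2) ^ i"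
        unfolding norm_mult norm_power using uv by (intro mult_mono power_mono) auto
      also have "\<dots> = (1 / 2) ^ (m - 2)" using that by (simp flip: power_add)
      finally show ?thesis .
    qed
    then have "norm (\<Sum>i<m - 1. u ^ (m - 1 - Suc i) * v ^ i) \<le> (\<Sum>i<m - 1. (1 / 2) ^ (m - 2))"
      by (rule sum_norm_le)
    also have "\<dots> = real (m - 1) / 2 ^ (m - 2)" by (simp add: power_divide)
    also have "\<dots> \<le> 1"
    proof -
      have "m - 1 \<le> 2 ^ (m - 2)" using less_exp[of "m - 2"] m_ge by linarith
      then have "real (m - 1) \<le> real (2 ^ (m - 2))" by (simp only: of_nat_le_iff)
      then show ?thesis by simp
    qed
    finally show "norm (\<Sum>i<m - 1. u ^ (m - 1 - Suc i) * v ^ i) \<le> 1" .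
  qed (use uv in auto)
  finally show ?thesis by simp
qed

lemma of_real_eta_equation:
  assumes "(real b - x) * x ^ (m - 1) = 1"
  shows "(of_nat b - complex_of_real x) * complex_of_real x ^ (m - 1) = 1"
proof -
  have "complex_of_real ((real b - x) * x ^ (m - 1)) = 1" using assms by simp
  then show ?thesis by simp
qed

text \<open>The Pisot property follows from the equation: by \<open>eta_root_unique\<close> every
  other root has modulus below 1.\<close>

lemma is_eta_iff:
  "is_eta b m x \<longleftrightarrow> real b - 1 < x \<and> x < real b \<and> (real b - x) * x ^ (m - 1) = 1"
proof
  assume "is_eta b m x"
  then show "real b - 1 < x \<and> x < real b \<and> (real b - x) * x ^ (m - 1) = 1"
    using eta_equation_iff[of x] by (auto simp: is_eta_def)
next
  assume x: "real b - 1 < x \<and> x < real b \<and> (real b - x) * x ^ (m - 1) = 1"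
  define P :: "int poly" where "P = monom 1 m + (monom (- int b) (m - 1) + monom 1 0)"
  have ev: "poly (map_poly of_int P) z = z ^ m - of_nat b * z ^ (m - 1) + 1"
    for z :: "'b::{comm_ring_1,ring_char_0}"
    unfolding P_def by (simp only: poly_map_poly_of_int_add poly_map_poly_of_int_monom) simp
  have cx: "(of_nat b - complex_of_real x) * complex_of_real x ^ (m - 1) = 1"
    using x of_real_eta_equation by blast
  have "pisot x"
  proof (rule pisotI[of P])
    show "lead_coeff P = 1"
      by (rule lead_coeff_eq_1I[of _ m]) (use m_ge in \<open>auto simp: P_def coeff_monom\<close>)
    show "poly (map_poly of_int P) x = 0" "poly (map_poly of_int P) (complex_of_real x) = 0"
      unfolding ev using eta_equation_iff x cx by auto
    show "x > 1" using x b_ge by simp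
    fix z :: complex assume "poly (map_poly of_int P) z = 0" "norm z \<ge> 1"
    then show "z = of_real x"
      using eta_root_unique[of z "of_real x"] cx x b_ge unfolding ev eta_equation_iff by simp
  qed
  then show "is_eta b m x" using x eta_equation_iff[of x] by (simp add: is_eta_def)
qed

lemma ex1_is_eta: "\<exists>!x. is_eta b m x"
proof (rule ex_ex1I)
  let ?f = "\<lambda>x. (real b - x) * x ^ (m - 1)"
  have "(real b - 1) ^ 1 \<le> (real b - 1) ^ (m - 1)"
    using b_ge m_ge by (intro power_increasing) auto
  then have fa: "1 < ?f (real b - 1)" using b_ge by simp
  have "\<exists>x\<ge>real b - 1. x \<le> real b \<and> ?f x = 1"
    by (rule IVT2') (use fa in \<open>auto intro!: continuous_intros\<close>)
  then obtain x where x: "real b - 1 \<le> x" "x \<le> real b" "?f x = 1" by blast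
  then have "x \<noteq> real b - 1" "x \<noteq> real b" using fa by auto
  then show "\<exists>x. is_eta b m x" using x unfolding is_eta_iff by (intro exI[of _ x]) auto
next
  fix x y assume "is_eta b m x" "is_eta b m y"
  then have a: "real b - 1 < x" "(real b - x) * x ^ (m - 1) = 1" "real b - 1 < y" "(real b - y) * y ^ (m - 1) = 1"
    by (auto simp: is_eta_iff)
  have "norm (complex_of_real x) \<ge> 1" "norm (complex_of_real y) \<ge> 1" using a(1,3) b_ge by auto
  then have "complex_of_real x = complex_of_real y"
    using eta_root_unique[OF of_real_eta_equation[OF a(2)] _ of_real_eta_equation[OF a(4)]] by blast
  then show "x = y" by simp
qed

section \<open>The equation of lambda\<close>

text \<open>The quotient x^m / (1 + x + ... + x^(m-1)) is strictly increasing; denominators are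
  cleared. Lambda is where it equals \<open>b - 1\<close>.\<close>

lemma sum_powers_strict:
  fixes x y :: real
  assumes "0 < x" "x < y"
  shows "x ^ m * (\<Sum>i<m. y ^ i) < y ^ m * (\<Sum>i<m. x ^ i)"
proof -
  have "x ^ m * y ^ i < y ^ m * x ^ i" if "i < m" for i
  proof -
    have "x ^ (m - i) * (x * y) ^ i < y ^ (m - i) * (x * y) ^ i"
      using assms that by (intro mult_strict_right_mono power_strict_mono) auto
    then have "x ^ (m - i) * x ^ i * y ^ i < y ^ (m - i) * y ^ i * x ^ i"
      by (simp add: power_mult_distrib algebra_simps)
    then show ?thesis using that by (simp flip: power_add)
  qed
  then have "(\<Sum>i<m. x ^ m * y ^ i) < (\<Sum>i<m. y ^ m * x ^ i)"
    using m_ge by (intro sum_strict_mono) (auto simp: lessThan_empty_iff)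
  then show ?thesis by (simp add: sum_distrib_left)
qed

text \<open>Multiplying by \<open>z - 1\<close> sums the geometric series and leaves a trinomial
  whose modulus is easy to control.\<close>

lemma lam_equation_times:
  "(z - 1) * (z ^ m - (of_nat b - 1) * (\<Sum>i<m. z ^ i)) = (of_nat b - 1) - (of_nat b - z) * z ^ m"
  for z :: "'a::{comm_ring_1}"
proof -
  have "(z - 1) * (\<Sum>i<m. z ^ i) = z ^ m - 1" by (rule power_diff_1_eq[symmetric])
  then have "(z - 1) * ((of_nat b - 1) * (\<Sum>i<m. z ^ i)) = (of_nat b - 1) * (z ^ m - 1)"
    by (metis mult.left_commute)
  then show ?thesis by (simp add: algebra_simps)
qed

text \<open>Put r = |z|. The triangle inequality and monotonicity give r <= lam. The trinomial gives
  |b - z| r^m = b - 1, whereas (b - r) r^m > b - 1 for 1 < r < lam; as |b - z| >= b - r, only r = 1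
  and r = lam remain. There |b - z| = b - r, which forces z = r, and z = 1 is no root.\<close>

lemma lam_root_unique:
  fixes z :: complex and lam :: real
  assumes lam: "1 < lam" "lam < real b" "lam ^ m = (real b - 1) * (\<Sum>i<m. lam ^ i)"
    and z: "z ^ m = (of_nat b - 1) * (\<Sum>i<m. z ^ i)" "norm z \<ge> 1"
  shows "z = of_real lam"
proof -
  define r where "r = norm z"
  have b1: "real b - 1 > 0" "norm (of_nat b - 1 :: complex) = real b - 1"
    using b_ge norm_of_nat[of "b - 1", where ?'a = complex] by (simp_all add: of_nat_diff)
  have r1: "r \<ge> 1" using z by (simp add: r_def)
  have le: "r \<le> lam"
  proof (rule ccontr)
    assume "\<not> r \<le> lam"
    then have "lam ^ m * (\<Sum>i<m. r ^ i) < r ^ m * (\<Sum>i<m. lam ^ i)" using lam by (intro sum_powers_strict) auto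
    moreover have "r ^ m \<le> (real b - 1) * (\<Sum>i<m. r ^ i)"
    proof -
      have "r ^ m = (real b - 1) * norm (\<Sum>i<m. z ^ i)"
        unfolding r_def using z(1) b1(2) by (metis norm_mult norm_power)
      also have "\<dots> \<le> (real b - 1) * (\<Sum>i<m. r ^ i)"
        using b1 by (intro mult_left_mono sum_norm_le) (auto simp: norm_power r_def)
      finally show ?thesis .
    qed
    then have "r ^ m * (\<Sum>i<m. lam ^ i) \<le> (real b - 1) * (\<Sum>i<m. r ^ i) * (\<Sum>i<m. lam ^ i)"
      using lam by (intro mult_right_mono sum_nonneg) auto
    ultimately show False using lam(3) by (simp add: algebra_simps)
  qed
  have "(of_nat b - 1) - (of_nat b - z) * z ^ m = 0"
    using lam_equation_times[of z] z(1) by simp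
  then have nz: "norm (of_nat b - z) * r ^ m = real b - 1"
    unfolding r_def using b1(2) by (metis eq_iff_diff_eq_0 norm_mult norm_power)
  have tri: "real b - r \<le> norm (of_nat b - z)"
    using norm_triangle_ineq2[of "of_nat b" z] by (simp add: r_def)
  have cases: "r = 1 \<or> r = lam"
  proof (rule ccontr)
    assume "\<not> (r = 1 \<or> r = lam)"
    then have r: "1 < r" "r < lam" using r1 le by auto
    have "r ^ m * (\<Sum>i<m. lam ^ i) < lam ^ m * (\<Sum>i<m. r ^ i)" using r by (intro sum_powers_strict) auto
    also have "\<dots> = (real b - 1) * (\<Sum>i<m. r ^ i) * (\<Sum>i<m. lam ^ i)" using lam by simp
    finally have "r ^ m < (real b - 1) * (\<Sum>i<m. r ^ i)"
      by (rule mult_right_less_imp_less) (use lam in \<open>auto intro: sum_nonneg\<close>)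
    then have "(r - 1) * (r ^ m - (real b - 1) * (\<Sum>i<m. r ^ i)) < 0"
      using r by (intro mult_pos_neg) auto
    then have "real b - 1 < (real b - r) * r ^ m" using lam_equation_times[of r] by simp
    also have "\<dots> \<le> norm (of_nat b - z) * r ^ m" using tri r by (intro mult_right_mono) auto
    finally show False using nz by simp
  qed
  have "(real b - r) * r ^ m = real b - 1"
    using cases lam lam_equation_times[of lam] by auto
  then have "norm (of_nat b - z) = real b - r" using nz r1 by (metis mult_cancel_right not_one_le_zero power_not_zero)
  then have eq: "(real b - Re z)\<^sup>2 + (Im z)\<^sup>2 = (real b - r)\<^sup>2"
    using cmod_power2[of "of_nat b - z"] by simp
  moreover have r2: "(Re z)\<^sup>2 + (Im z)\<^sup>2 = r\<^sup>2" using cmod_power2[of z] by (simp add: r_def)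
  moreover have "2 * real b * (Re z - r) = ((Re z)\<^sup>2 + (Im z)\<^sup>2 - r\<^sup>2) -
      ((real b - Re z)\<^sup>2 + (Im z)\<^sup>2 - (real b - r)\<^sup>2)"
    by (simp add: power2_eq_square algebra_simps)
  ultimately have "2 * real b * (Re z - r) = 0" by simp
  then have "Re z = r" using b_ge by simp
  moreover from this have "Im z = 0" using r2 by simp
  ultimately have zr: "z = of_real r" by (simp add: complex_eq_iff)
  have "r \<noteq> 1"
  proof
    assume "r = 1"
    then have "(1::complex) = (of_nat b - 1) * of_nat m" using z(1) zr by simp
    then have "norm (1::complex) = (real b - 1) * real m" using b1(2) by (metis norm_mult norm_of_nat)
    moreover have "2 * 2 \<le> (real b - 1) * real m" using b_ge m_ge by (intro mult_mono) auto
    ultimately show False by simp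
  qed
  then show ?thesis using zr cases by simp
qed

lemma of_real_lam_equation:
  assumes "lam ^ m = (real b - 1) * (\<Sum>i<m. lam ^ i)"
  shows "complex_of_real lam ^ m = (of_nat b - 1) * (\<Sum>i<m. complex_of_real lam ^ i)"
proof -
  have "complex_of_real (lam ^ m) = complex_of_real ((real b - 1) * (\<Sum>i<m. lam ^ i))"
    using assms by simp
  then show ?thesis by simp
qed

lemma is_lambda_iff:
  "is_lambda b m x \<longleftrightarrow> real b - 1 < x \<and> x < real b \<and> x ^ m = (real b - 1) * (\<Sum>i<m. x ^ i)"
proof
  assume x: "real b - 1 < x \<and> x < real b \<and> x ^ m = (real b - 1) * (\<Sum>i<m. x ^ i)"
  define P :: "int poly" where "P = monom 1 m + (\<Sum>i<m. monom (1 - int b) i)"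
  have ev: "poly (map_poly of_int P) z = z ^ m - (of_nat b - 1) * (\<Sum>i<m. z ^ i)"
    for z :: "'b::{comm_ring_1,ring_char_0}"
    unfolding P_def
    by (simp only: poly_map_poly_of_int_add poly_map_poly_of_int_monom poly_map_poly_of_int_sum_monom)
      (simp add: algebra_simps)
  have "pisot x"
  proof (rule pisotI[of P])
    show "lead_coeff P = 1"
      by (rule lead_coeff_eq_1I[of _ m]) (auto simp: P_def coeff_monom coeff_sum)
    show "poly (map_poly of_int P) x = 0" "poly (map_poly of_int P) (complex_of_real x) = 0"
      unfolding ev using x of_real_lam_equation[of x] by auto
    show "x > 1" using x b_ge by simp
    fix z :: complex assume "poly (map_poly of_int P) z = 0" "norm z \<ge> 1"
    then show "z = of_real x"
      using lam_root_unique[of x z] x b_ge unfolding ev by simp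
  qed
  then show "is_lambda b m x" using x by (simp add: is_lambda_def)
qed (auto simp: is_lambda_def)

lemma ex1_is_lambda: "\<exists>!x. is_lambda b m x"
proof (rule ex_ex1I)
  let ?f = "\<lambda>x. x ^ m - (real b - 1) * (\<Sum>i<m. x ^ i)"
  \<comment> \<open>The summand \<open>i = m - 1\<close> alone cancels the leading power, and
    \<open>m >= 2\<close> leaves further positive summands.\<close>
  have fa: "?f (real b - 1) < 0"
  proof -
    have m: "m = Suc (m - 1)" using m_ge by simp
    have "(real b - 1) * (\<Sum>i<m. (real b - 1) ^ i) = (\<Sum>i<m. (real b - 1) ^ Suc i)"
      by (simp add: sum_distrib_left)
    also have "\<dots> = (\<Sum>i<m - 1. (real b - 1) ^ Suc i) + (real b - 1) ^ Suc (m - 1)"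
      by (subst m) (rule sum.lessThan_Suc)
    finally have "(real b - 1) * (\<Sum>i<m. (real b - 1) ^ i) =
        (\<Sum>i<m - 1. (real b - 1) ^ Suc i) + (real b - 1) ^ m"
      using m by simp
    moreover have "(\<Sum>i<m - 1. (real b - 1) ^ Suc i) > 0"
      using m_ge b_ge by (intro sum_pos) (auto simp: lessThan_empty_iff)
    ultimately show ?thesis by linarith
  qed
  have "real b ^ m - 1 = (real b - 1) * (\<Sum>i<m. real b ^ i)" by (rule power_diff_1_eq)
  then have fb: "?f (real b) = 1" by simp
  have "\<exists>x\<ge>real b - 1. x \<le> real b \<and> ?f x = 0"
    by (rule IVT') (use fa fb in \<open>auto intro!: continuous_intros\<close>)
  then obtain x where x: "real b - 1 \<le> x" "x \<le> real b" "?f x = 0" by blast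
  then have "x \<noteq> real b - 1" "x \<noteq> real b" using fa fb by auto
  then show "\<exists>x. is_lambda b m x" using x unfolding is_lambda_iff by (intro exI[of _ x]) auto
next
  fix x y assume "is_lambda b m x" "is_lambda b m y"
  then have a: "real b - 1 < x" "x < real b" "x ^ m = (real b - 1) * (\<Sum>i<m. x ^ i)"
    "real b - 1 < y" "y ^ m = (real b - 1) * (\<Sum>i<m. y ^ i)"
    by (auto simp: is_lambda_iff)
  then have "complex_of_real y = complex_of_real x"
    by (intro lam_root_unique of_real_lam_equation) (use b_ge in auto)
  then show "x = y" by simp
qed

end

section \<open>Exponents\<close>

text \<open>Up to an error of order 1 / (p + q), \<open>v p q\<close> is the average of
  \<open>c\<close> and \<open>a\<close> with weights \<open>p\<close> and \<open>q\<close>, and such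
  averages with large \<open>p + q\<close> approximate every point of the interval.\<close>

lemma dense_in_if_approx:
  fixes v :: "nat \<Rightarrow> nat \<Rightarrow> real"
  assumes range: "\<And>p q. p \<ge> 1 \<Longrightarrow> q \<ge> 1 \<Longrightarrow> v p q \<in> {a..c}"
    and approx: "\<And>p q. p \<ge> 1 \<Longrightarrow> q \<ge> 1 \<Longrightarrow> \<bar>real (p + q) * v p q - (p * c + q * a)\<bar> \<le> K"
  shows "dense_in {v p q | p q. p \<ge> 1 \<and> q \<ge> 1} {a..c}"
  unfolding dense_in_def
proof
  show "{v p q | p q. p \<ge> 1 \<and> q \<ge> 1} \<subseteq> {a..c}" using range by auto
  show "{a..c} \<subseteq> closure {v p q | p q. p \<ge> 1 \<and> q \<ge> 1}"
    unfolding closure_approachable subset_iff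
  proof (intro allI impI)
    fix y e :: real assume y: "y \<in> {a..c}" and e: "0 < e"
    \<comment> \<open>If \<open>a = c\<close>, division by zero gives \<open>t = 0\<close>, which
      still represents \<open>y\<close>.\<close>
    define t where "t = (y - a) / (c - a)"
    have t: "0 \<le> t" "t \<le> 1" "y = a + t * (c - a)"
      using y by (auto simp: t_def divide_le_eq_1)
    obtain n where n: "real n > (K + 2 * (c - a)) / e" using reals_Archimedean2 by blast
    \<comment> \<open>The extra 1 here and 2 in \<open>q\<close> keep both at least 1; rounding
      moves \<open>p\<close> by at most 2 from its ideal share of \<open>n + 2\<close>.\<close>
    define p where "p = nat \<lfloor>t * n\<rfloor> + 1"
    define q where "q = n + 2 - p"
    have "t * n \<le> 1 * real n" using t by (intro mult_right_mono) auto
    then have "\<lfloor>t * n\<rfloor> \<le> n" by linarith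
    then have pq: "p \<ge> 1" "q \<ge> 1" "p + q = n + 2" by (auto simp: p_def q_def)
    have "real p = of_int \<lfloor>t * n\<rfloor> + 1" using t by (simp add: p_def)
    then have "real p \<le> t * n + 1" "t * n \<le> real p" by linarith+
    then have "\<bar>real p - t * (n + 2)\<bar> \<le> 2" using t by (simp add: abs_le_iff algebra_simps)
    then have "\<bar>real p - t * (n + 2)\<bar> * (c - a) \<le> 2 * (c - a)"
      using y by (intro mult_right_mono) auto
    then have "\<bar>(real p - t * (n + 2)) * (c - a)\<bar> \<le> 2 * (c - a)" using y by (simp add: abs_mult)
    moreover have rq: "real q = real n + 2 - real p" using pq(3) by linarith
    have "(p * c + q * a) - real (n + 2) * y = (real p - t * (n + 2)) * (c - a)"
      unfolding t(3) rq by (simp add: algebra_simps)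
    moreover have "\<bar>real (n + 2) * v p q - (p * c + q * a)\<bar> \<le> K" using approx[OF pq(1,2)] pq(3) by simp
    ultimately have "\<bar>real (n + 2) * v p q - real (n + 2) * y\<bar> \<le> K + 2 * (c - a)" by linarith
    moreover have "real (n + 2) * dist (v p q) y = \<bar>real (n + 2) * (v p q - y)\<bar>"
      by (simp only: dist_real_def abs_mult abs_of_nat)
    ultimately have "real (n + 2) * dist (v p q) y \<le> K + 2 * (c - a)"
      by (simp only: right_diff_distrib)
    also have "\<dots> < real n * e" using n e by (simp add: field_simps)
    also have "\<dots> \<le> real (n + 2) * e" using e by (intro mult_right_mono) auto
    finally have "dist (v p q) y < e" by simp
    then show "\<exists>z\<in>{v p q | p q. p \<ge> 1 \<and> q \<ge> 1}. dist z y < e" using pq by blast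
  qed
qed

context forbidden_words
begin

section \<open>Exponents of the sets for p and q\<close>

lemma N_bounds_add:
  shows "real (N \<omega> n) \<le> real (N \<omega> (n + r))" and "real (N \<omega> (n + r)) \<le> real b ^ r * real (N \<omega> n)"
proof -
  obtain eta where "is_eta b m eta" using ex1_is_eta by blast
  then have eta: "(real b - eta) * eta ^ (m - 1) = 1" "eta \<ge> 1" "eta \<le> real b"
    using b_ge by (auto simp: is_eta_iff)
  show "real (N \<omega> n) \<le> real (N \<omega> (n + r))"
  proof (induction r)
    case (Suc r)
    have "1 * real (N \<omega> (n + r)) \<le> eta * real (N \<omega> (n + r))" using eta by (intro mult_right_mono) auto
    also have "\<dots> \<le> real (N \<omega> (n + Suc r))" using N_Suc_ge_eta[OF eta, of \<omega> "n + r"] by simp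
    finally show ?case using Suc by simp
  qed simp
  show "real (N \<omega> (n + r)) \<le> real b ^ r * real (N \<omega> n)"
  proof (induction r)
    case (Suc r)
    have "real (N \<omega> (n + Suc r)) \<le> real (b * N \<omega> (n + r))" using N_Suc_le[of \<omega> "n + r"] by (simp only: of_nat_le_iff add_Suc_right)
    also have "\<dots> \<le> real b * (real b ^ r * real (N \<omega> n))" using Suc by (simp add: mult_left_mono)
    finally show ?case by (simp add: mult.assoc)
  qed simp
qed

lemma ahlfors_regular_if_periodic_growth:
  assumes "P \<ge> 1" and \<Lambda>: "\<Lambda> > 1"
    and lower: "\<And>l. \<Lambda> ^ l \<le> real (N \<omega> (l * P))" and upper: "\<And>l. real (N \<omega> (l * P)) \<le> D * \<Lambda> ^ l"
  shows "ahlfors_regular (ln \<Lambda> / (real P * ln (real b))) (K_set b m \<omega>)"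
proof (rule ahlfors_regular_K_set)
  let ?s = "ln \<Lambda> / (real P * ln (real b))"
  let ?B = "real b powr ?s"
  \<comment> \<open>For lengths between multiples of \<open>P\<close>, the summand \<Lambda> serves
    the lower bound and \<open>b ^ P * D\<close> the upper one.\<close>
  let ?C = "\<Lambda> + real b ^ P * D"
  show s: "?s > 0" using assms b_ge by simp
  have B1: "?B > 1" using s b_ge by simp
  have "?B ^ P = exp (ln \<Lambda>)"
    using assms b_ge by (simp add: powr_def flip: exp_of_nat_mult)
  then have BP: "?B ^ P = \<Lambda>" using \<Lambda> by simp
  have D: "D \<ge> 1" using lower[of 0] upper[of 0] by simp
  show "?C \<ge> 1" using \<Lambda> D by (simp add: add_increasing2)
  fix n
  define l r where "l = n div P" and "r = n mod P"
  have n: "n = l * P + r" by (simp only: l_def r_def div_mult_mod_eq)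
  have r: "r < P" using assms by (simp add: r_def)
  have Bn: "?B ^ n = \<Lambda> ^ l * ?B ^ r"
  proof -
    have "?B ^ n = ?B ^ (P * l) * ?B ^ r" by (simp only: n power_add mult.commute)
    then show ?thesis by (simp only: power_mult BP)
  qed
  have Br: "1 \<le> ?B ^ r" "?B ^ r \<le> \<Lambda>"
    using B1 r power_increasing[of r P ?B] BP by (auto intro: one_le_power)
  have "?B ^ n \<le> \<Lambda> ^ l * \<Lambda>" unfolding Bn using Br \<Lambda> by (intro mult_left_mono) auto
  also have "\<dots> \<le> real (N \<omega> n) * ?C"
    using lower[of l] N_bounds_add(1)[of \<omega> "l * P" r] n \<Lambda> D by (intro mult_mono) auto
  finally show "?B ^ n \<le> ?C * real (N \<omega> n)" by (simp add: mult.commute)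
  have "real (N \<omega> n) \<le> real b ^ r * real (N \<omega> (l * P))" unfolding n by (rule N_bounds_add(2))
  also have "\<dots> \<le> real b ^ P * (D * \<Lambda> ^ l)"
    using upper[of l] r b_ge by (intro mult_mono power_increasing) auto
  also have "\<dots> = (real b ^ P * D) * (\<Lambda> ^ l * 1)" by simp
  also have "\<dots> \<le> ?C * (\<Lambda> ^ l * ?B ^ r)"
    using Br \<Lambda> D by (intro mult_mono) auto
  finally show "real (N \<omega> n) \<le> ?C * ?B ^ n" unfolding Bn .
qed

lemma is_etaD:
  assumes "is_eta b m eta"
  shows "(real b - eta) * eta ^ (m - 1) = 1" "eta \<ge> 2" "eta \<le> real b"
  using assms b_ge by (auto simp: is_eta_iff)

lemma is_lambdaD:
  assumes "is_lambda b m lam"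
  shows "lam ^ m = (real b - 1) * (\<Sum>i<m. lam ^ i)" "lam \<ge> 1" "lam \<le> real b"
  using assms b_ge by (auto simp: is_lambda_iff)

text \<open>Compared through counting: for any sequence of forbidden words, here the constant zero
  word, the counts lie between eta^n and a multiple of lam^n.\<close>

lemma eta_le_lam:
  assumes "is_eta b m eta" "is_lambda b m lam"
  shows "eta \<le> lam"
proof (rule le_if_powers_le)
  let ?\<omega> = "\<lambda>_::nat. replicate m (0::nat)"
  note eta = is_etaD[OF assms(1)] and lam = is_lambdaD[OF assms(2)]
  show "eta ^ n \<le> real b ^ m * lam ^ n" for n
  proof -
    have "eta ^ n \<le> real (N ?\<omega> n)" using eta by (intro N_ge_eta) auto
    also have "\<dots> \<le> real b ^ m * lam ^ n" using lam b_ge by (intro N_le_lam) (auto simp: words_def)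
    finally show ?thesis .
  qed
  show "lam > 0" using lam by simp
qed

text \<open>\<open>4 ^ (m - 1)\<close> combines the losses of \<open>N_supermult\<close> and
  \<open>L_set_growth\<close>; the other factors come from \<open>N_le_lam\<close> and
  \<open>N_le_eta\<close>. Independence of \<open>p\<close> and \<open>q\<close> is what density
  requires.\<close>

definition R :: real where
  "R = 4 ^ (m - 1) * real b ^ m * (1 + real b ^ m)"

lemma R_ge: "R \<ge> 1" "R \<ge> 4 ^ (m - 1)" "R \<ge> real b ^ m * (1 + real b ^ m)"
proof -
  have 1: "(4::real) ^ (m - 1) \<ge> 1" "real b ^ m \<ge> 1" using b_ge by (auto intro: one_le_power)
  then have 2: "1 * 1 \<le> real b ^ m * (1 + real b ^ m)" by (intro mult_mono) auto
  have "4 ^ (m - 1) * 1 \<le> 4 ^ (m - 1) * (real b ^ m * (1 + real b ^ m))"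
    using 2 by (intro mult_left_mono) auto
  then show "R \<ge> 4 ^ (m - 1)" by (simp add: R_def mult.assoc)
  then show "R \<ge> 1" using 1 by linarith
  have "1 * (real b ^ m * (1 + real b ^ m)) \<le> 4 ^ (m - 1) * (real b ^ m * (1 + real b ^ m))"
    using 1 2 by (intro mult_right_mono) auto
  then show "R \<ge> real b ^ m * (1 + real b ^ m)" by (simp add: R_def mult.assoc)
qed

text \<open>Over one period \<Lambda> is comparable to \<open>N \<omega> (p + q)\<close>, hence to
  \<open>N \<omega> p\<close> times the count of length \<open>q\<close> for the sequence shifted by
  \<open>p\<close>. The first factor sees only progressive positions, the second only totally
  distinct ones.\<close>

lemma L_set_exponent:
  assumes eta: "is_eta b m eta" and lam: "is_lambda b m lam" and "p \<ge> 1"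
  shows "\<exists>\<Lambda>>1. (\<forall>\<omega>\<in>L_set b m p q. ahlfors_regular (ln \<Lambda> / (real (p + q) * ln (real b))) (K_set b m \<omega>)) \<and>
    eta ^ (p + q) \<le> \<Lambda> \<and> \<Lambda> \<le> lam ^ (p + q) \<and> lam ^ p * eta ^ q \<le> R * \<Lambda> \<and> \<Lambda> \<le> R * (lam ^ p * eta ^ q)"
proof (cases "L_set b m p q = {}")
  case True
  \<comment> \<open>Regularity is then vacuous and any value with the right bounds will do, so it is not
    necessary to construct elements of \<open>L_set\<close>.\<close>
  let ?E = "lam ^ p * eta ^ q"
  note e = is_etaD(2)[OF eta] and le = eta_le_lam[OF eta lam]
  have "eta ^ (p + q) \<le> ?E" "?E \<le> lam ^ (p + q)"
    unfolding power_add using e le by (auto intro!: mult_mono power_mono)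
  moreover have "eta ^ (p + q) > 1" using e assms(3) by (intro one_less_power) auto
  moreover have "1 * ?E \<le> R * ?E" using R_ge e le by (intro mult_right_mono) auto
  ultimately show ?thesis using True by (intro exI[of _ ?E]) auto
next
  case False
  then obtain \<omega> where \<omega>: "\<omega> \<in> L_set b m p q" by blast
  let ?P = "p + q"
  obtain \<Lambda> where \<Lambda>0: "\<Lambda> > 0" and
    growth: "\<And>\<omega> l. \<omega> \<in> L_set b m p q \<Longrightarrow> \<Lambda> ^ l \<le> real (N \<omega> (l * ?P)) \<and> real (N \<omega> (l * ?P)) \<le> 2 ^ (m - 1) * \<Lambda> ^ l"
    using L_set_growth[OF \<omega> assms(3)] by blast
  note e = is_etaD[OF eta] and l = is_lambdaD[OF lam]
  have words: "\<omega> k \<in> words b m" for k using L_setD(1)[OF \<omega>] .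
  \<comment> \<open>No constant may remain in this bound and the next, since they place the exponent
    inside the interval; hence the comparison over \<open>n\<close> periods for all
    \<open>n\<close>.\<close>
  have lower: "eta ^ ?P \<le> \<Lambda>"
  proof (rule le_if_powers_le[OF _ \<Lambda>0])
    fix n
    have "(eta ^ ?P) ^ n = eta ^ (n * ?P)" by (simp add: mult.commute flip: power_mult)
    also have "\<dots> \<le> real (N \<omega> (n * ?P))" using e by (intro N_ge_eta) auto
    also have "\<dots> \<le> 2 ^ (m - 1) * \<Lambda> ^ n" using growth[OF \<omega>] by blast
    finally show "(eta ^ ?P) ^ n \<le> 2 ^ (m - 1) * \<Lambda> ^ n" .
  qed
  have upper: "\<Lambda> \<le> lam ^ ?P"
  proof (rule le_if_powers_le)
    fix n
    have "\<Lambda> ^ n \<le> real (N \<omega> (n * ?P))" using growth[OF \<omega>] by blast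
    also have "\<dots> \<le> real b ^ m * lam ^ (n * ?P)" by (rule N_le_lam[OF words l(1,2)])
    also have "\<dots> = real b ^ m * (lam ^ ?P) ^ n" by (simp add: mult.commute flip: power_mult)
    finally show "\<Lambda> ^ n \<le> real b ^ m * (lam ^ ?P) ^ n" .
  qed (use l in simp)
  have "1 < eta ^ ?P" using e assms(3) by (intro one_less_power) auto
  then have \<Lambda>1: "\<Lambda> > 1" using lower by simp
  have td: "totally_distinct m (shifted p \<omega>) k" if "1 \<le> k" "k \<le> q" for k
    by (rule totally_distinct_shifted, rule L_setD(3)[OF \<omega>, of 0]) (use that in auto)
  have po: "progressively_overlapping m \<omega> k" if "1 \<le> k" "k \<le> p" for k
    by (rule L_setD(2)[OF \<omega>, of 0]) (use that in auto)
  have sw: "shifted p \<omega> k \<in> words b m" for k using words by (simp add: shifted_def)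
  have gr: "\<Lambda> \<le> real (N \<omega> ?P)" "real (N \<omega> ?P) \<le> 2 ^ (m - 1) * \<Lambda>"
    using growth[OF \<omega>, of 1] by simp_all
  have "lam ^ p * eta ^ q \<le> real (N \<omega> p) * real (N (shifted p \<omega>) q)"
    using N_ge_lam[OF words l po order_refl] N_ge_eta[OF e(1) _ e(3), of q "shifted p \<omega>"] e l
    by (intro mult_mono) auto
  also have "\<dots> \<le> 2 ^ (m - 1) * real (N \<omega> ?P)"
  proof -
    have "real (N \<omega> p * N (shifted p \<omega>) q) \<le> real (2 ^ (m - 1) * N \<omega> ?P)"
      unfolding of_nat_le_iff by (rule N_supermult)
    then show ?thesis by simp
  qed
  also have "\<dots> \<le> 2 ^ (m - 1) * (2 ^ (m - 1) * \<Lambda>)" using gr by (intro mult_left_mono) auto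
  also have "\<dots> = 4 ^ (m - 1) * \<Lambda>" by (simp flip: power_mult_distrib mult.assoc)
  also have "\<dots> \<le> R * \<Lambda>" using R_ge \<Lambda>0 by (intro mult_right_mono) auto
  finally have 1: "lam ^ p * eta ^ q \<le> R * \<Lambda>" .
  have "\<Lambda> \<le> real (N \<omega> p * N (shifted p \<omega>) q)"
    using gr(1) N_submult[of \<omega> p q] by (meson of_nat_le_iff order_trans)
  also have "\<dots> \<le> (real b ^ m * lam ^ p) * ((1 + real b ^ m) * eta ^ q)"
    unfolding of_nat_mult using N_le_lam[where n = p, OF words l(1,2)] N_le_eta[OF e sw td order_refl] l
    by (intro mult_mono) auto
  also have "\<dots> = (real b ^ m * (1 + real b ^ m)) * (lam ^ p * eta ^ q)" by simp
  also have "\<dots> \<le> R * (lam ^ p * eta ^ q)" using R_ge e l by (intro mult_right_mono) auto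
  finally have 2: "\<Lambda> \<le> R * (lam ^ p * eta ^ q)" .
  have "ahlfors_regular (ln \<Lambda> / (real ?P * ln (real b))) (K_set b m \<omega>')" if "\<omega>' \<in> L_set b m p q" for \<omega>'
    by (rule ahlfors_regular_if_periodic_growth[OF _ \<Lambda>1])
      (use growth[OF that] assms(3) in auto)
  then show ?thesis using \<Lambda>1 lower upper 1 2 by blast
qed

lemma L_set_exponents_dense:
  "\<exists>\<Lambda> :: nat \<Rightarrow> nat \<Rightarrow> real.
    (\<forall>p q. p \<ge> 1 \<longrightarrow> q \<ge> 1 \<longrightarrow> \<Lambda> p q > 1 \<and>
       (\<forall>\<omega> \<in> L_set b m p q. ahlfors_regular (ln (\<Lambda> p q) / (real (p + q) * ln (real b))) (K_set b m \<omega>))) \<and>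
    (\<forall>lam eta. is_lambda b m lam \<longrightarrow> is_eta b m eta \<longrightarrow>
       dense_in {ln (\<Lambda> p q) / (real (p + q) * ln (real b)) | p q. p \<ge> 1 \<and> q \<ge> 1}
         {ln eta / ln (real b)..ln lam / ln (real b)})"
proof -
  obtain lam eta where lam: "is_lambda b m lam" and eta: "is_eta b m eta"
    using ex1_is_lambda ex1_is_eta by blast
  obtain \<Lambda> :: "nat \<Rightarrow> nat \<Rightarrow> real" where \<Lambda>: "\<And>p q. p \<ge> 1 \<Longrightarrow> \<Lambda> p q > 1 \<and>
      (\<forall>\<omega>\<in>L_set b m p q. ahlfors_regular (ln (\<Lambda> p q) / (real (p + q) * ln (real b))) (K_set b m \<omega>)) \<and>
      eta ^ (p + q) \<le> \<Lambda> p q \<and> \<Lambda> p q \<le> lam ^ (p + q) \<and>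
      lam ^ p * eta ^ q \<le> R * \<Lambda> p q \<and> \<Lambda> p q \<le> R * (lam ^ p * eta ^ q)"
    using L_set_exponent[OF eta lam] by metis
  have lb: "ln (real b) > 0" using b_ge by simp
  have pos: "eta > 0" "lam > 0" using is_etaD[OF eta] is_lambdaD[OF lam] by auto
  have "dense_in {ln (\<Lambda> p q) / (real (p + q) * ln (real b)) | p q. p \<ge> 1 \<and> q \<ge> 1}
         {ln eta / ln (real b)..ln lam / ln (real b)}"
  proof (rule dense_in_if_approx)
    fix p q :: nat assume pq: "p \<ge> 1" "q \<ge> 1"
    note L = \<Lambda>[OF pq(1), of q]
    have L0: "\<Lambda> p q > 0" using L by simp
    have "ln (eta ^ (p + q)) \<le> ln (\<Lambda> p q)" "ln (\<Lambda> p q) \<le> ln (lam ^ (p + q))"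
      using L L0 pos by (simp_all add: ln_le_cancel_iff del: ln_realpow)
    then have "real (p + q) * ln eta \<le> ln (\<Lambda> p q)" "ln (\<Lambda> p q) \<le> real (p + q) * ln lam"
      using pos by (simp_all only: ln_realpow)
    moreover have "real (p + q) > 0" using pq by simp
    ultimately have "ln eta \<le> ln (\<Lambda> p q) / real (p + q)" "ln (\<Lambda> p q) / real (p + q) \<le> ln lam"
      by (simp_all only: pos_le_divide_eq pos_divide_le_eq mult.commute)
    then show "ln (\<Lambda> p q) / (real (p + q) * ln (real b)) \<in> {ln eta / ln (real b)..ln lam / ln (real b)}"
      unfolding atLeastAtMost_iff divide_divide_eq_left[symmetric]
      using lb by (intro conjI divide_right_mono) auto
    have E0: "lam ^ p * eta ^ q > 0" using pos by simp
    have "ln (lam ^ p * eta ^ q) \<le> ln (R * \<Lambda> p q)" "ln (\<Lambda> p q) \<le> ln (R * (lam ^ p * eta ^ q))"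
      using L L0 E0 R_ge(1) by (auto intro!: ln_mono mult_pos_pos)
    then have "\<bar>ln (\<Lambda> p q) - ln (lam ^ p * eta ^ q)\<bar> \<le> ln R"
      using L0 E0 R_ge(1) by (simp add: ln_mult_pos abs_le_iff)
    then have "\<bar>ln (\<Lambda> p q) - (p * ln lam + q * ln eta)\<bar> / ln (real b) \<le> ln R / ln (real b)"
      using lb pos by (intro divide_right_mono) (simp_all add: ln_mult_pos ln_realpow)
    moreover have "real (p + q) * (ln (\<Lambda> p q) / (real (p + q) * ln (real b))) = ln (\<Lambda> p q) / ln (real b)"
      using pq by (simp del: of_nat_add)
    then have "real (p + q) * (ln (\<Lambda> p q) / (real (p + q) * ln (real b))) -
        (p * (ln lam / ln (real b)) + q * (ln eta / ln (real b))) =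
        (ln (\<Lambda> p q) - (p * ln lam + q * ln eta)) / ln (real b)"
      by (simp only: diff_divide_distrib add_divide_distrib times_divide_eq_right)
    ultimately show "\<bar>real (p + q) * (ln (\<Lambda> p q) / (real (p + q) * ln (real b))) -
        (p * (ln lam / ln (real b)) + q * (ln eta / ln (real b)))\<bar> \<le> ln R / ln (real b)"
      using lb by (simp only: abs_divide abs_of_pos)
  qed
  \<comment> \<open>The rates were chosen for one fixed pair of roots; uniqueness extends the claim
    to every pair in the statement.\<close>
  moreover have "lam' = lam" "eta' = eta" if "is_lambda b m lam'" "is_eta b m eta'" for lam' eta'
    using ex1_is_lambda ex1_is_eta lam eta that by blast+
  ultimately show ?thesis using \<Lambda> by (intro exI[of _ \<Lambda>]) blast
qed

end

theorem theorem1p8: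
  fixes b m :: nat
  assumes "b \<ge> 3" and "m \<ge> 2"
  shows "\<exists>\<Lambda> :: nat \<Rightarrow> nat \<Rightarrow> real.
    (\<forall>p q. p \<ge> 1 \<longrightarrow> q \<ge> 1 \<longrightarrow> \<Lambda> p q > 1 \<and>
       (\<forall>\<omega> \<in> L_set b m p q. ahlfors_regular (ln (\<Lambda> p q) / (real (p + q) * ln (real b))) (K_set b m \<omega>))) \<and>
    (\<exists>!lam. is_lambda b m lam) \<and> (\<exists>!eta. is_eta b m eta) \<and>
    (\<forall>lam eta. is_lambda b m lam \<longrightarrow> is_eta b m eta \<longrightarrow>
       dense_in {ln (\<Lambda> p q) / (real (p + q) * ln (real b)) | p q. p \<ge> 1 \<and> q \<ge> 1}
         {ln eta / ln (real b)..ln lam / ln (real b)})"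
proof -
  interpret forbidden_words b m by unfold_locales (use assms in auto)
  show ?thesis using L_set_exponents_dense ex1_is_lambda ex1_is_eta by blast
qed

end
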